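(* Let $G$ be a connected $d$-regular simple graph with $d\ge 3$ which is not $K_4$, $K_5$, or $K_{3,3}$. Then \[ 1-\frac{2}{d}<\frac{\mathscr{K}_{nb}(G)}{\mathscr{K}_e(G)}<1. \]
   Context: Kemeny's constant of an irreducible finite Markov chain with transition matrix $P$ whose eigenvalues (with multiplicity) are $1=\rho_1,\rho_2,\dots,\rho_N$ (with $1$ simple) is $\mathscr{K}(P)=\sum_{i=2}^{N}\frac{1}{1-\rho_i}$. Arcs of $G$: for each edge $\{u,v\}$ the two ordered pairs $(u,v),(v,u)$. $\mathscr{K}_e(G)$ is Kemeny's constant of the chain on arcs where from $(u,v)$ one moves to $(v,w)$ with probability $1/\deg(v)$ for each neighbor $w$ of $v$. $\mathscr{K}_{nb}(G)$ is Kemeny's constant of the non-backtracking chain on arcs where from $(u,v)$ one moves to $(v,w)$ with probability $1/(\deg(v)-1)$ for each neighbor $w\neq u$ of $v$. *)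

theory Defs
  imports "Jordan_Normal_Form.Char_Poly" "HOL-Computational_Algebra.Polynomial"
begin

section \<open>Kemeny's constant\<close>

text \<open>Eigenvalues with multiplicity of a square complex matrix are the roots (proots) (with
  multiplicity) of its characteristic polynomial. One copy of the eigenvalue 1 is removed
  and the remaining terms 1/(1 - rho) are summed.  For a real matrix the non-real
  eigenvalues come in conjugate pairs, so this sum is real; we take its real part.\<close>

definition kemeny :: "complex mat \<Rightarrow> real" where
  "kemeny P = Re (\<Sum>\<rho>\<in>#(proots (char_poly P) - {#1#}). 1 / (1 - \<rho>))"

section \<open>Simple graphs\<close>

text \<open>A simple graph is given by a finite vertex set V and a symmetric irreflexive
  adjacency relation E supported on V.\<close>

definition simple_graph :: "'a set \<Rightarrow> ('a \<Rightarrow> 'a \<Rightarrow> bool) \<Rightarrow> bool" where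
  "simple_graph V E \<longleftrightarrow> finite V \<and> (\<forall>u v. E u v \<longrightarrow> u \<in> V \<and> v \<in> V)
     \<and> (\<forall>u v. E u v \<longrightarrow> E v u) \<and> (\<forall>u. \<not> E u u)"

definition degree :: "'a set \<Rightarrow> ('a \<Rightarrow> 'a \<Rightarrow> bool) \<Rightarrow> 'a \<Rightarrow> nat" where
  "degree V E v = card {w \<in> V. E v w}"

definition regular :: "'a set \<Rightarrow> ('a \<Rightarrow> 'a \<Rightarrow> bool) \<Rightarrow> nat \<Rightarrow> bool" where
  "regular V E d \<longleftrightarrow> (\<forall>v\<in>V. degree V E v = d)"

definition connected_graph :: "'a set \<Rightarrow> ('a \<Rightarrow> 'a \<Rightarrow> bool) \<Rightarrow> bool" where
  "connected_graph V E \<longleftrightarrow> V \<noteq> {} \<and>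
     (\<forall>u\<in>V. \<forall>v\<in>V. (u, v) \<in> {(x, y). E x y}\<^sup>*)"

definition graph_iso :: "'a set \<Rightarrow> ('a \<Rightarrow> 'a \<Rightarrow> bool) \<Rightarrow> 'b set \<Rightarrow> ('b \<Rightarrow> 'b \<Rightarrow> bool) \<Rightarrow> bool" where
  "graph_iso V E W F \<longleftrightarrow>
     (\<exists>f. bij_betw f V W \<and> (\<forall>u\<in>V. \<forall>v\<in>V. E u v \<longleftrightarrow> F (f u) (f v)))"

text \<open>Complete graph K_n on {0..<n} and complete bipartite graph K_{3,3} on {0..<6}
  with parts {0,1,2} and {3,4,5}.\<close>

definition K_verts :: "nat \<Rightarrow> nat set" where "K_verts n = {0..<n}"
definition K_adj :: "nat \<Rightarrow> nat \<Rightarrow> bool" where "K_adj u v \<longleftrightarrow> u \<noteq> v"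

definition K33_verts :: "nat set" where "K33_verts = {0..<6}"
definition K33_adj :: "nat \<Rightarrow> nat \<Rightarrow> bool" where "K33_adj u v \<longleftrightarrow> (u < 3 \<longleftrightarrow> 3 \<le> v)"

section \<open>Arcs and the two random walks on arcs\<close>

definition arcs :: "'a set \<Rightarrow> ('a \<Rightarrow> 'a \<Rightarrow> bool) \<Rightarrow> ('a \<times> 'a) set" where
  "arcs V E = {(u, v). u \<in> V \<and> v \<in> V \<and> E u v}"

text \<open>A fixed enumeration of the arcs (Kemeny's constant does not depend on it,
  since relabelling states conjugates the transition matrix by a permutation).\<close>

definition arc_list :: "'a set \<Rightarrow> ('a \<Rightarrow> 'a \<Rightarrow> bool) \<Rightarrow> ('a \<times> 'a) list" where
  "arc_list V E = (SOME xs. distinct xs \<and> set xs = arcs V E)"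

text \<open>Edge walk: from (u,v) move to (v,w) with probability 1/deg(v), w any neighbour of v.\<close>

definition edge_walk_matrix :: "'a set \<Rightarrow> ('a \<Rightarrow> 'a \<Rightarrow> bool) \<Rightarrow> complex mat" where
  "edge_walk_matrix V E =
     (let xs = arc_list V E in
      mat (length xs) (length xs) (\<lambda>(i, j).
        if snd (xs ! i) = fst (xs ! j)
        then 1 / of_nat (degree V E (snd (xs ! i))) else 0))"

text \<open>Non-backtracking walk: from (u,v) move to (v,w) with probability 1/(deg(v)-1),
  w any neighbour of v other than u.\<close>

definition nb_walk_matrix :: "'a set \<Rightarrow> ('a \<Rightarrow> 'a \<Rightarrow> bool) \<Rightarrow> complex mat" where
  "nb_walk_matrix V E =
     (let xs = arc_list V E in
      mat (length xs) (length xs) (\<lambda>(i, j).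
        if snd (xs ! i) = fst (xs ! j) \<and> snd (xs ! j) \<noteq> fst (xs ! i)
        then 1 / (of_nat (degree V E (snd (xs ! i))) - 1) else 0))"

definition kemeny_e :: "'a set \<Rightarrow> ('a \<Rightarrow> 'a \<Rightarrow> bool) \<Rightarrow> real" where
  "kemeny_e V E = kemeny (edge_walk_matrix V E)"

definition kemeny_nb :: "'a set \<Rightarrow> ('a \<Rightarrow> 'a \<Rightarrow> bool) \<Rightarrow> real" where
  "kemeny_nb V E = kemeny (nb_walk_matrix V E)"

end

theory Submission
  imports Defs "Jordan_Normal_Form.Schur_Decomposition"
begin

text \<open>
  Let A be the adjacency matrix, with eigenvalues d and l_2, ..., l_n, and let K be the sum of
  d / (d - l_i) over i \<ge> 2. Factoring the edge walk through the vertices, and using the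
  Ihara--Bass determinant formula for the non-backtracking walk, gives
  K_e = n (d - 1) + K and
  K_nb = n (d - 1)^2 / d + (d - 1) / (d - 2) + (n - 1) + (1 - 2 / d) K.
  The lower bound is then immediate, and the upper bound is equivalent to
  K > n / 2 + d / (2 (d - 2)).
  As the l_i are real and sum to - d, convexity gives K \<ge> (n - 1)^2 / n, which suffices except
  when (d, n) is (3, 4), (4, 5) or (3, 6); the pair (3, 5) is impossible by parity.
  The first two are K_4 and K_5. For (3, 6) a cubic minorant of 1 / (1 - x) that touches it at 0
  and at - 1, the values of l_i / d for K_{3,3}, yields K \<ge> 9 / 2 + tr(A^3) / 108, and a
  triangle-free graph of this size is K_{3,3}.
\<close>

section \<open>Characteristic polynomials and traces\<close>

text \<open>Two obstacles shape the proof. The terms d / (d - l_i) and the convexity argument need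
  every l_i to be real and strictly below d, with d counted once as a root of the characteristic
  polynomial. Connectedness only shows that the eigenfunctions for d are constant, which is a
  geometric multiplicity. Passing to A - J, with J the all-ones matrix, turns this into the
  algebraic statement without diagonalising A. The second obstacle is the exponent N / 2 and the
  sign in the determinant of z I - R, with R the arc reversal. The Ihara--Bass identity is therefore
  squared and kept free of division by z^2 - 1. Summing over roots turns products into sums, so the
  square becomes a factor 2. The excluded graphs are genuine exceptions. The threshold n / 2 + d /
  (2 (d - 2)) is 7 / 2 for K_4 and for K_5, where K is 9 / 4 and 16 / 5. For K_{3,3} both the
  threshold and K are 9 / 2 and the ratio is exactly 1, so the case (3, 6) leaves no slack for an
  estimate that is not sharp at K_{3,3}.\<close>

lemma poly_char_poly_eq_det:
  fixes A :: "'a :: field mat"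
  assumes A: "A \<in> carrier_mat n n"
  shows "poly (char_poly A) k = det (k \<cdot>\<^sub>m 1\<^sub>m n - A)"
  unfolding char_poly_def
  by (rule poly_det_cong[of _ n]) (use A in \<open>auto simp: char_poly_matrix_def\<close>)

lemma char_poly_zero_mat: "char_poly (0\<^sub>m n n :: 'a :: comm_ring_1 mat) = [:0, 1:] ^ n"
proof -
  have "char_poly (0\<^sub>m n n :: 'a mat) = (\<Prod>a\<leftarrow>diag_mat (0\<^sub>m n n :: 'a mat). [:- a, 1:])"
    by (rule char_poly_upper_triangular) auto
  also have "diag_mat (0\<^sub>m n n :: 'a mat) = replicate n 0"
    by (rule nth_equalityI) (auto simp: diag_mat_def)
  finally show ?thesis by simp
qed

text \<open>This is the homogenised characteristic polynomial. The case \<open>b = 0\<close> matters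
  because \<open>b\<close> becomes the free variable z of the Ihara--Bass identity, which runs
  through all complex numbers.\<close>

lemma det_pencil:
  fixes A :: "'a :: field mat"
  assumes A: "A \<in> carrier_mat n n" and es: "char_poly A = (\<Prod>e\<leftarrow>es. [:- e, 1:])" "length es = n"
  shows "det (a \<cdot>\<^sub>m 1\<^sub>m n - b \<cdot>\<^sub>m A) = (\<Prod>e\<leftarrow>es. a - b * e)"
proof (cases "b = 0")
  case True
  then have "a \<cdot>\<^sub>m 1\<^sub>m n - b \<cdot>\<^sub>m A = a \<cdot>\<^sub>m 1\<^sub>m n" using A by (intro eq_matI) auto
  then show ?thesis using True es(2) by (simp add: map_replicate_const)
next
  case False
  then have "a \<cdot>\<^sub>m 1\<^sub>m n - b \<cdot>\<^sub>m A = b \<cdot>\<^sub>m ((a / b) \<cdot>\<^sub>m 1\<^sub>m n - A)"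
    using A by (intro eq_matI) (auto simp: field_simps)
  then have "det (a \<cdot>\<^sub>m 1\<^sub>m n - b \<cdot>\<^sub>m A) = b ^ n * poly (char_poly A) (a / b)"
    using A by (simp add: poly_char_poly_eq_det[OF A])
  also have "\<dots> = (\<Prod>e\<leftarrow>es. a - b * e)"
    unfolding es(1) es(2)[symmetric] using False
    by (induction es) (auto simp: field_simps)
  finally show ?thesis .
qed

text \<open>The block matrices \<open>?X\<close> and \<open>?Y\<close> are conjugate by the
  unipotent matrix \<open>?P\<close>, whose inverse is \<open>?Q\<close>. Powers of the variable
  stand on both sides, so neither dimension has to be the larger one.\<close>

lemma char_poly_mult_swap:
  fixes M S :: "complex mat"
  assumes M: "M \<in> carrier_mat N n" and S: "S \<in> carrier_mat n N"
  shows "char_poly (M * S) * [:0, 1:] ^ n = [:0, 1:] ^ N * char_poly (S * M)"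
proof -
  let ?X = "four_block_mat (M * S) (0\<^sub>m N n) S (0\<^sub>m n n)"
  let ?Y = "four_block_mat (0\<^sub>m N N) (0\<^sub>m N n) S (S * M)"
  let ?P = "four_block_mat (1\<^sub>m N) M (0\<^sub>m n N) (1\<^sub>m n)"
  let ?Q = "four_block_mat (1\<^sub>m N) (- M) (0\<^sub>m n N) (1\<^sub>m n)"
  have MS: "M * S \<in> carrier_mat N N" and SM: "S * M \<in> carrier_mat n n" using M S by auto
  have nM: "- M \<in> carrier_mat N n" using M by auto
  have [simp]: "- 0\<^sub>m n n + 1\<^sub>m n = (1\<^sub>m n :: complex mat)" by (rule eq_matI) auto
  have [simp]: "M + - M = 0\<^sub>m N n" using M by (intro eq_matI) auto
  have PQ: "?P * ?Q = 1\<^sub>m (N + n)"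
    by (subst mult_four_block_mat[of _ N N _ n _ n]) (use M nM in \<open>auto simp: uminus_l_inv_mat\<close>)
  have QP: "?Q * ?P = 1\<^sub>m (N + n)"
    by (subst mult_four_block_mat[of _ N N _ n _ n]) (use M nM in \<open>auto\<close>)
  have PY: "?P * ?Y = four_block_mat (M * S) (M * (S * M)) S (S * M)"
    by (subst mult_four_block_mat[of _ N N _ n _ n]) (use M S SM in auto)
  have PYQ: "?P * ?Y * ?Q = ?X"
    unfolding PY
    by (subst mult_four_block_mat[of _ N N _ n _ n])
      (use M S SM MS nM in \<open>auto simp: uminus_mult_right_mat assoc_mult_mat[OF M S M] uminus_l_inv_mat\<close>)
  have "similar_mat ?X ?Y"
    by (rule similar_matI[of _ _ ?P ?Q "N + n"]) (use PQ QP PYQ M S MS SM nM in auto)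
  then have sim: "char_poly ?X = char_poly ?Y" by (rule char_poly_similar)
  have linear: "\<exists>es. char_poly A = (\<Prod>a\<leftarrow>es. [:- a, 1:])" if "A \<in> carrier_mat k k" for A :: "complex mat" and k
    using char_poly_factorized[OF that] by (elim exE conjE) (rule exI)
  have "char_poly ?X = char_poly (M * S) * char_poly (0\<^sub>m n n)"
    by (rule char_poly_0_block'[OF refl linear[OF MS] linear[OF zero_carrier_mat] MS S zero_carrier_mat])
  moreover have "char_poly ?Y = char_poly (0\<^sub>m N N) * char_poly (S * M)"
    by (rule char_poly_0_block'[OF refl linear[OF zero_carrier_mat] linear[OF SM] zero_carrier_mat S SM])
  ultimately show ?thesis using sim by (simp add: char_poly_zero_mat)
qed

section \<open>Traces of powers as power sums of the eigenvalues\<close>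

lemma trace_mult_comm:
  fixes A B :: "'a :: comm_semiring_0 mat"
  assumes "A \<in> carrier_mat n m" "B \<in> carrier_mat m n"
  shows "(\<Sum>i<n. (A * B) $$ (i, i)) = (\<Sum>i<m. (B * A) $$ (i, i))"
proof -
  have "(\<Sum>i<n. (A * B) $$ (i, i)) = (\<Sum>i<n. \<Sum>j<m. A $$ (i, j) * B $$ (j, i))"
    using assms by (auto simp: scalar_prod_def lessThan_atLeast0 intro!: sum.cong)
  also have "\<dots> = (\<Sum>j<m. \<Sum>i<n. A $$ (i, j) * B $$ (j, i))" by (rule sum.swap)
  also have "\<dots> = (\<Sum>i<m. (B * A) $$ (i, i))"
    using assms by (auto simp: scalar_prod_def lessThan_atLeast0 mult.commute intro!: sum.cong)
  finally show ?thesis .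
qed

lemma upper_triangular_mult:
  fixes A B :: "'a :: semiring_0 mat"
  assumes A: "A \<in> carrier_mat n n" "upper_triangular A" and B: "B \<in> carrier_mat n n" "upper_triangular B"
  shows "upper_triangular (A * B)" "\<And>i. i < n \<Longrightarrow> (A * B) $$ (i, i) = A $$ (i, i) * B $$ (i, i)"
proof -
  have z: "A $$ (i, k) * B $$ (k, j) = 0" if "i < n" "k < n" "j \<le> i" "k \<noteq> i \<or> j \<noteq> i" for i j k
    using that A B upper_triangularD[OF A(2)] upper_triangularD[OF B(2)]
    by (cases "k < i") auto
  show "upper_triangular (A * B)"
  proof (rule upper_triangularI)
    fix i j assume "j < i" "i < dim_row (A * B)"
    then show "(A * B) $$ (i, j) = 0"
      using A(1) B(1) z[of i _ j] by (auto simp: scalar_prod_def)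
  qed
  fix i assume i: "i < n"
  have "(A * B) $$ (i, i) = (\<Sum>k\<in>{0..<n}. A $$ (i, k) * B $$ (k, i))"
    using A(1) B(1) i by (auto simp: scalar_prod_def)
  also have "\<dots> = (\<Sum>k\<in>{i}. A $$ (i, k) * B $$ (k, i))"
    by (rule sum.mono_neutral_right) (use i z in auto)
  finally show "(A * B) $$ (i, i) = A $$ (i, i) * B $$ (i, i)" by simp
qed

lemma upper_triangular_pow:
  fixes B :: "'a :: semiring_1 mat"
  assumes B: "B \<in> carrier_mat n n" "upper_triangular B"
  shows "upper_triangular (B ^\<^sub>m k) \<and> (\<forall>i<n. (B ^\<^sub>m k) $$ (i, i) = B $$ (i, i) ^ k)"
proof (induction k)
  case 0
  then show ?case using B by auto
next
  case (Suc k)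
  have "B ^\<^sub>m k \<in> carrier_mat n n" using B by simp
  from upper_triangular_mult[OF this _ B] Suc show ?case
    by (auto simp: power_commutes)
qed

lemma trace_pow_eq_sum_eigenvalues:
  fixes A :: "complex mat"
  assumes A: "A \<in> carrier_mat n n" and es: "char_poly A = (\<Prod>e\<leftarrow>es. [:- e, 1:])"
  shows "(\<Sum>i<n. (A ^\<^sub>m k) $$ (i, i)) = (\<Sum>e\<leftarrow>es. e ^ k)"
proof -
  obtain B P Q where dec: "schur_decomposition A es = (B, P, Q)"
    by (cases "schur_decomposition A es") auto
  from schur_decomposition[OF A es dec]
  have sim: "similar_mat_wit A B P Q" and ut: "upper_triangular B" and diag: "diag_mat B = es" by auto
  from similar_mat_witD2[OF A sim]
  have c: "B \<in> carrier_mat n n" "P \<in> carrier_mat n n" "Q \<in> carrier_mat n n" and QP: "Q * P = 1\<^sub>m n" by auto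
  have Bk: "B ^\<^sub>m k \<in> carrier_mat n n" using c by simp
  have "A ^\<^sub>m k = P * (B ^\<^sub>m k * Q)"
    using similar_mat_wit_pow_id[OF sim, of k] assoc_mult_mat[OF c(2) Bk c(3)] by simp
  then have "(\<Sum>i<n. (A ^\<^sub>m k) $$ (i, i)) = (\<Sum>i<n. (B ^\<^sub>m k * Q * P) $$ (i, i))"
    using trace_mult_comm[of P n n "B ^\<^sub>m k * Q"] c Bk by (metis mult_carrier_mat)
  also have "B ^\<^sub>m k * Q * P = B ^\<^sub>m k"
    using assoc_mult_mat[OF Bk c(3) c(2)] QP right_mult_one_mat[OF Bk] by simp
  also have "(\<Sum>i<n. (B ^\<^sub>m k) $$ (i, i)) = (\<Sum>i<n. B $$ (i, i) ^ k)"
    using upper_triangular_pow[OF c(1) ut] by simp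
  also have "\<dots> = (\<Sum>e\<leftarrow>es. e ^ k)"
    unfolding diag[symmetric] diag_mat_def using c(1)
    by (simp add: sum_list_distinct_conv_sum_set comp_def lessThan_atLeast0)
  finally show ?thesis .
qed

lemma mult_mat_index:
  "i < a \<Longrightarrow> j < c \<Longrightarrow> (mat a b f * mat b c g) $$ (i, j) = (\<Sum>k<b. f (i, k) * g (k, j))"
  by (simp add: scalar_prod_def lessThan_atLeast0)

section \<open>Sums over the roots of a polynomial\<close>

text \<open>For nonzero p with p(1) nonzero this is the logarithmic derivative p'(1) / p(1). Its
  additivity over products turns factorisations of characteristic polynomials into formulas for
  Kemeny's constant.\<close>

definition root_sum :: "complex poly \<Rightarrow> complex" where
  "root_sum p = (\<Sum>\<rho>\<in>#proots p. 1 / (1 - \<rho>))"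

text \<open>Since 1 / 0 = 0, the root 1 contributes nothing to the sum, so removing it does not matter.\<close>

lemma kemeny_eq_root_sum: "kemeny P = Re (root_sum (char_poly P))"
proof (cases "1 \<in># proots (char_poly P)")
  case True
  then obtain M where "proots (char_poly P) = add_mset 1 M" by (metis mset_add)
  then show ?thesis by (simp add: kemeny_def root_sum_def)
next
  case False
  then show ?thesis by (simp add: kemeny_def root_sum_def)
qed

lemma root_sum_mult: "p \<noteq> 0 \<Longrightarrow> q \<noteq> 0 \<Longrightarrow> root_sum (p * q) = root_sum p + root_sum q"
  by (simp add: root_sum_def proots_mult)

lemma root_sum_1 [simp]: "root_sum 1 = 0"
  by (simp add: root_sum_def)

lemma root_sum_power: "p \<noteq> 0 \<Longrightarrow> root_sum (p ^ k) = of_nat k * root_sum p"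
  by (induction k) (simp_all add: root_sum_mult algebra_simps)

lemma root_sum_linear: "root_sum [:- a, 1:] = 1 / (1 - a)"
  by (simp add: root_sum_def)

lemma root_sum_prod_list:
  "0 \<notin> set ps \<Longrightarrow> root_sum (prod_list ps) = (\<Sum>p\<leftarrow>ps. root_sum p)"
  by (induction ps) (auto simp: root_sum_mult prod_list_zero_iff)

text \<open>The sum of 1 / (1 - a) and 1 / (1 - b) is symmetric in the two roots, so only
  \<open>s\<close> and \<open>p\<close> survive. The hypothesis says that 1 is not a root.\<close>

lemma root_sum_quadratic:
  assumes "1 - s + p \<noteq> 0"
  shows "root_sum [:p, - s, 1:] = (2 - s) / (1 - s + p)"
proof -
  define a b where "a = (s + csqrt (s\<^sup>2 - 4 * p)) / 2" and "b = (s - csqrt (s\<^sup>2 - 4 * p)) / 2"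
  have ab: "a + b = s" "a * b = p"
    by (auto simp: a_def b_def field_simps power2_eq_square[symmetric] power2_csqrt)
  have fac: "[:p, - s, 1:] = [:- a, 1:] * [:- b, 1:]" using ab by (simp add: algebra_simps)
  have "(1 - a) * (1 - b) = 1 - s + p" using ab by (auto simp: algebra_simps)
  with assms have nz: "1 - a \<noteq> 0" "1 - b \<noteq> 0" by auto
  have "root_sum [:p, - s, 1:] = 1 / (1 - a) + 1 / (1 - b)"
    unfolding fac by (subst root_sum_mult) (simp_all only: root_sum_linear pCons_eq_0_iff, auto)
  also have "\<dots> = (2 - (a + b)) / ((1 - a) * (1 - b))" using nz by (simp add: divide_simps) algebra
  also have "\<dots> = (2 - s) / (1 - s + p)" using ab by (simp add: algebra_simps)
  finally show ?thesis .
qed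

text \<open>The cubic is the Hermite interpolant of 1 / (1 - x) with double nodes 0 and - 1. The gap
  is x^2 (1 + x)^2 / (4 (1 - x)).\<close>

lemma inverse_cubic_bound:
  fixes x :: real
  assumes "x < 1"
  shows "1 + x + 3 / 4 * x ^ 2 + 1 / 4 * x ^ 3 \<le> 1 / (1 - x)"
proof -
  have "1 - (1 + x + 3 / 4 * x ^ 2 + 1 / 4 * x ^ 3) * (1 - x) = x\<^sup>2 * (1 + x)\<^sup>2 / 4"
    by (simp add: power2_eq_square power3_eq_cube field_simps)
  moreover have "x\<^sup>2 * (1 + x)\<^sup>2 / 4 \<ge> 0" by simp
  ultimately have "(1 + x + 3 / 4 * x ^ 2 + 1 / 4 * x ^ 3) * (1 - x) \<le> 1" by linarith
  then show ?thesis using assms by (simp add: pos_le_divide_eq)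
qed

section \<open>The spectrum of the adjacency matrix\<close>

locale connected_regular_graph =
  fixes V :: "'a set" and E :: "'a \<Rightarrow> 'a \<Rightarrow> bool" and d :: nat
  assumes simple: "simple_graph V E" and conn: "connected_graph V E" and reg: "regular V E d"
begin

lemma finite_V: "finite V" and E_sym: "E u v \<Longrightarrow> E v u" and E_irrefl: "\<not> E u u"
  and E_V: "E u v \<Longrightarrow> u \<in> V" "E u v \<Longrightarrow> v \<in> V"
  using simple by (auto simp: simple_graph_def)

definition verts :: "'a list" where
  "verts = (SOME vs. distinct vs \<and> set vs = V)"

lemma verts: "distinct verts" "set verts = V"
proof -
  have "\<exists>vs. distinct vs \<and> set vs = V" using finite_distinct_list[OF finite_V] by blast
  from someI_ex[OF this] show "distinct verts" "set verts = V" by (auto simp: verts_def)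
qed

abbreviation n :: nat where "n \<equiv> length verts"

lemma card_V: "card V = n"
  using verts distinct_card by fastforce

lemma n_pos: "n > 0"
  using conn verts by (auto simp: connected_graph_def)

lemma verts_in: "i < n \<Longrightarrow> verts ! i \<in> V"
  using verts(2) nth_mem by blast

lemma verts_eq_iff: "i < n \<Longrightarrow> j < n \<Longrightarrow> verts ! i = verts ! j \<longleftrightarrow> i = j"
  using verts(1) by (simp add: nth_eq_iff_index_eq)

lemma sum_verts: "(\<Sum>i<n. f (verts ! i)) = (\<Sum>v\<in>V. f v)"
  using sum.reindex_bij_betw[OF bij_betw_nth[OF verts(1), of "{..<n}" V], of f] verts by simp

lemma sum_adj: "v \<in> V \<Longrightarrow> (\<Sum>w\<in>V. of_bool (E v w) * c) = of_nat d * (c :: 'b :: semiring_1)"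
proof -
  assume v: "v \<in> V"
  have "(\<Sum>w\<in>V. of_bool (E v w) * c) = (\<Sum>w\<in>V. of_bool (E v w)) * c" by (simp add: sum_distrib_right)
  also have "(\<Sum>w\<in>V. of_bool (E v w)) = (\<Sum>w\<in>{w\<in>V. E v w}. 1 :: 'b)"
    using finite_V by (intro sum.mono_neutral_cong_right) auto
  also have "\<dots> = of_nat d" using reg v by (simp add: regular_def degree_def)
  finally show ?thesis .
qed

definition adj :: "complex mat" where
  "adj = mat n n (\<lambda>(i, j). of_bool (E (verts ! i) (verts ! j)))"

lemma adj_carrier [simp]: "adj \<in> carrier_mat n n"
  by (simp add: adj_def)

lemma adj_index: "i < n \<Longrightarrow> j < n \<Longrightarrow> adj $$ (i, j) = of_bool (E (verts ! i) (verts ! j))"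
  by (simp add: adj_def)

definition ones :: "complex mat" where "ones = mat n n (\<lambda>_. 1)"

lemma ones_carrier [simp]: "ones \<in> carrier_mat n n"
  by (simp add: ones_def)

text \<open>Functions on \<open>V\<close> replace vectors, so that the later sums run over vertices
  instead of indices. The kernel \<open>g\<close> is left general because both A and A - J are
  treated this way.\<close>

lemma eigenfunction:
  assumes "eigenvalue (mat n n (\<lambda>(i, j). g (verts ! i) (verts ! j))) e"
  obtains f :: "'a \<Rightarrow> complex" where "\<exists>v\<in>V. f v \<noteq> 0" "\<And>v. v \<in> V \<Longrightarrow> (\<Sum>w\<in>V. g v w * f w) = e * f v"
proof -
  let ?M = "mat n n (\<lambda>(i, j). g (verts ! i) (verts ! j))"
  from assms obtain x where x: "x \<in> carrier_vec n" "x \<noteq> 0\<^sub>v n" "?M *\<^sub>v x = e \<cdot>\<^sub>v x"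
    by (auto simp: eigenvalue_def eigenvector_def)
  define f where "f v = x $ (THE i. i < n \<and> verts ! i = v)" for v
  have f: "f (verts ! i) = x $ i" if "i < n" for i
  proof -
    have "(THE j. j < n \<and> verts ! j = verts ! i) = i" using that verts_eq_iff by (intro the_equality) auto
    then show ?thesis by (simp add: f_def)
  qed
  from x obtain i where i: "i < n" "x $ i \<noteq> 0" by (metis carrier_vecD eq_vecI index_zero_vec)
  then have "\<exists>v\<in>V. f v \<noteq> 0" using f verts_in by metis
  moreover have "(\<Sum>w\<in>V. g v w * f w) = e * f v" if "v \<in> V" for v
  proof -
    from that verts obtain i where i: "i < n" "v = verts ! i" by (metis in_set_conv_nth)
    have "(?M *\<^sub>v x) $ i = (\<Sum>j<n. g (verts ! i) (verts ! j) * f (verts ! j))"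
      using i x(1) f by (simp add: scalar_prod_def lessThan_atLeast0)
    also have "\<dots> = (\<Sum>w\<in>V. g v w * f w)" unfolding i(2) by (rule sum_verts)
    finally show ?thesis using x i f by simp
  qed
  ultimately show ?thesis by (rule that)
qed

text \<open>The form \<open>S\<close> equals its own conjugate because adjacency is symmetric, hence
  \<open>e\<close> is real. The last identity computes the Dirichlet energy of \<open>f\<close>: its
  nonnegativity gives Re e \<le> d, and its vanishing for e = d makes \<open>f\<close> equal at the
  ends of every edge.\<close>

lemma rayleigh:
  fixes f :: "'a \<Rightarrow> complex"
  assumes f: "\<And>v. v \<in> V \<Longrightarrow> (\<Sum>w\<in>V. of_bool (E v w) * f w) = e * f v"
    and nz: "\<exists>v\<in>V. f v \<noteq> 0"
  defines "r \<equiv> \<Sum>v\<in>V. (cmod (f v))\<^sup>2"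
  shows "r > 0" "e \<in> \<real>"
    "(\<Sum>v\<in>V. \<Sum>w\<in>V. of_bool (E v w) * (cmod (f v - f w))\<^sup>2) = 2 * (real d - Re e) * r"
proof -
  show r: "r > 0" unfolding r_def
  proof -
    from nz obtain v where "v \<in> V" "f v \<noteq> 0" by blast
    then show "0 < (\<Sum>v\<in>V. (cmod (f v))\<^sup>2)" using finite_V by (intro sum_pos2[of _ v]) auto
  qed
  define S where "S = (\<Sum>v\<in>V. \<Sum>w\<in>V. of_bool (E v w) * (cnj (f v) * f w))"
  have "S = (\<Sum>v\<in>V. cnj (f v) * (\<Sum>w\<in>V. of_bool (E v w) * f w))"
    unfolding S_def sum_distrib_left by (simp add: algebra_simps)
  also have "\<dots> = (\<Sum>v\<in>V. e * of_real ((cmod (f v))\<^sup>2))"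
    by (rule sum.cong[OF refl]) (simp only: f complex_norm_square, simp add: algebra_simps)
  finally have Se: "S = e * of_real r" unfolding r_def by (simp add: sum_distrib_left)
  have "cnj S = (\<Sum>v\<in>V. \<Sum>w\<in>V. of_bool (E v w) * (cnj (f w) * f v))"
  proof -
    have [simp]: "cnj (of_bool b) = of_bool b" for b by (cases b) auto
    show ?thesis unfolding S_def by (simp add: mult.commute)
  qed
  also have "\<dots> = (\<Sum>w\<in>V. \<Sum>v\<in>V. of_bool (E v w) * (cnj (f w) * f v))" by (rule sum.swap)
  also have "\<dots> = S" unfolding S_def using E_sym by (intro sum.cong refl) (auto simp: of_bool_def)
  finally have "cnj e * of_real r = e * of_real r" by (simp add: Se)
  then show "e \<in> \<real>" using r by (simp add: Reals_cnj_iff)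
  have expand: "(cmod (f v - f w))\<^sup>2 = (cmod (f v))\<^sup>2 + (cmod (f w))\<^sup>2 - 2 * Re (cnj (f v) * f w)" for v w
    unfolding cmod_power2 by (simp add: power2_eq_square algebra_simps)
  have 1: "(\<Sum>v\<in>V. \<Sum>w\<in>V. of_bool (E v w) * (cmod (f v))\<^sup>2) = real d * r"
    by (simp add: sum_adj r_def sum_distrib_left)
  have 2: "(\<Sum>v\<in>V. \<Sum>w\<in>V. of_bool (E v w) * (cmod (f w))\<^sup>2) = real d * r"
  proof -
    have "(\<Sum>v\<in>V. \<Sum>w\<in>V. of_bool (E v w) * (cmod (f w))\<^sup>2) = (\<Sum>w\<in>V. \<Sum>v\<in>V. of_bool (E w v) * (cmod (f w))\<^sup>2)"
      by (subst sum.swap) (use E_sym in \<open>auto intro!: sum.cong simp: of_bool_def\<close>)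
    then show ?thesis by (simp add: sum_adj r_def sum_distrib_left)
  qed
  have 3: "(\<Sum>v\<in>V. \<Sum>w\<in>V. of_bool (E v w) * (2 * Re (cnj (f v) * f w))) = 2 * Re S"
    unfolding S_def Re_sum sum_distrib_left by (intro sum.cong refl) auto
  have "(\<Sum>v\<in>V. \<Sum>w\<in>V. of_bool (E v w) * (cmod (f v - f w))\<^sup>2) = real d * r + real d * r - 2 * Re S"
    unfolding expand distrib_left right_diff_distrib sum.distrib sum_subtractf 1 2 3 ..
  also have "Re S = Re e * r" by (simp add: Se)
  finally show "(\<Sum>v\<in>V. \<Sum>w\<in>V. of_bool (E v w) * (cmod (f v - f w))\<^sup>2) = 2 * (real d - Re e) * r"
    by (simp add: algebra_simps)
qed

lemma eigenvalue_adj_real: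
  assumes "eigenvalue adj e"
  shows "e \<in> \<real>" "Re e \<le> real d"
proof -
  obtain f where f: "\<exists>v\<in>V. f v \<noteq> 0" "\<And>v. v \<in> V \<Longrightarrow> (\<Sum>w\<in>V. of_bool (E v w) * f w) = e * f v"
    using eigenfunction[of "\<lambda>u v. of_bool (E u v)" e] assms unfolding adj_def by blast
  note ray = rayleigh[OF f(2) f(1)]
  show "e \<in> \<real>" by (rule ray(2))
  have "0 \<le> (\<Sum>v\<in>V. \<Sum>w\<in>V. of_bool (E v w) * (cmod (f v - f w))\<^sup>2)"
    by (intro sum_nonneg) auto
  then show "Re e \<le> real d" using ray(1,3) by (simp add: zero_le_mult_iff)
qed

lemma harmonic_const:
  fixes f :: "'a \<Rightarrow> complex"
  assumes f: "\<And>v. v \<in> V \<Longrightarrow> (\<Sum>w\<in>V. of_bool (E v w) * f w) = of_nat d * f v"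
    and uv: "u \<in> V" "v \<in> V"
  shows "f u = f v"
proof (cases "\<exists>v\<in>V. f v \<noteq> 0")
  case True
  have "(\<Sum>v\<in>V. \<Sum>w\<in>V. of_bool (E v w) * (cmod (f v - f w))\<^sup>2) = 0"
    using rayleigh(3)[OF f True] by simp
  then have "\<forall>v\<in>V. \<forall>w\<in>V. of_bool (E v w) * (cmod (f v - f w))\<^sup>2 = 0"
    using finite_V by (simp add: sum_nonneg_eq_0_iff sum_nonneg)
  then have edge: "f v = f w" if "E v w" for v w using that E_V[of v w] by auto
  have "(u, v) \<in> {(x, y). E x y}\<^sup>*" using conn uv by (auto simp: connected_graph_def)
  then show ?thesis by (induction rule: rtrancl_induct) (auto dest: edge)
qed (use uv in auto)

section \<open>Simplicity of the eigenvalue d\<close>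

lemma det_one_minus_ones: "y \<noteq> 0 \<Longrightarrow> det (1\<^sub>m n - (1 / y) \<cdot>\<^sub>m ones) = (y - of_nat n) / y"
proof -
  assume y: "y \<noteq> 0"
  \<comment> \<open>The all-ones matrix is a column times a row, so swapping the factors leaves a 1
    by 1 determinant.\<close>
  define M S :: "complex mat" where "M = mat n 1 (\<lambda>_. 1)" and "S = mat 1 n (\<lambda>_. 1)"
  have MS: "M * S = ones" by (rule eq_matI) (auto simp: M_def S_def ones_def scalar_prod_def)
  have SM: "y \<cdot>\<^sub>m 1\<^sub>m 1 - S * M = mat 1 1 (\<lambda>_. y - of_nat n)"
    by (rule eq_matI) (auto simp: M_def S_def scalar_prod_def)
  have c: "M \<in> carrier_mat n 1" "S \<in> carrier_mat 1 n" by (auto simp: M_def S_def)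
  have "poly (char_poly (M * S)) y * y = y ^ n * poly (char_poly (S * M)) y"
    using arg_cong[OF char_poly_mult_swap[OF c], of "\<lambda>p. poly p y"] by (simp add: mult.commute)
  moreover have "poly (char_poly (S * M)) y = y - of_nat n"
    using c SM by (subst poly_char_poly_eq_det[of _ 1]) (auto simp: det_single)
  moreover have "poly (char_poly (M * S)) y = y ^ n * det (1\<^sub>m n - (1 / y) \<cdot>\<^sub>m ones)"
  proof -
    have "y \<cdot>\<^sub>m 1\<^sub>m n - ones = y \<cdot>\<^sub>m (1\<^sub>m n - (1 / y) \<cdot>\<^sub>m ones)"
      using y by (intro eq_matI) (auto simp: field_simps ones_def)
    then show ?thesis unfolding MS poly_char_poly_eq_det[OF ones_carrier]
      by (simp only: det_smult) (simp add: ones_def)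
  qed
  ultimately have "y ^ n * (y * det (1\<^sub>m n - (1 / y) \<cdot>\<^sub>m ones)) = y ^ n * (y - of_nat n)"
    by (simp add: mult_ac)
  then have "y * det (1\<^sub>m n - (1 / y) \<cdot>\<^sub>m ones) = y - of_nat n" using y by simp
  then show ?thesis using y by (simp add: field_simps)
qed

lemma adj_times_ones: "adj * ones = of_nat d \<cdot>\<^sub>m ones"
proof (rule eq_matI, goal_cases)
  case (1 i j)
  then have ij: "i < n" "j < n" by (auto simp: ones_def)
  then have "(adj * ones) $$ (i, j) = (\<Sum>k<n. of_bool (E (verts ! i) (verts ! k)) * 1)"
    by (simp add: adj_def ones_def scalar_prod_def lessThan_atLeast0)
  also have "\<dots> = of_nat d" 
    using sum_verts[of "\<lambda>w. of_bool (E (verts ! i) w) * (1 :: complex)"] sum_adj[OF verts_in[OF ij(1)], of "1 :: complex"]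
    by simp
  finally show ?case using ij by (simp add: ones_def)
qed (auto simp: adj_def ones_def)

text \<open>For x distinct from d one has (x I - A) (I + J / (x - d)) = x I - A + J, because A J = d J.
  Subtracting J moves one copy of the eigenvalue d to d - n, so d is a simple eigenvalue of A as
  soon as it is not an eigenvalue of A - J.\<close>

lemma char_poly_adj_deflate:
  "[:- of_nat d, 1:] * char_poly (adj - ones) = char_poly adj * [:of_nat n - of_nat d, 1:]"
    (is "?p = ?q")
proof -
  have eq: "poly ?p x = poly ?q x" if x: "x \<noteq> of_nat d" for x
  proof -
    define y where "y = of_nat d - x"
    have y: "y \<noteq> 0" using x by (simp add: y_def)
    let ?X = "x \<cdot>\<^sub>m 1\<^sub>m n - adj"
    have X: "?X \<in> carrier_mat n n" by (rule minus_carrier_mat) simp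
    have "?X * (1\<^sub>m n - (1 / y) \<cdot>\<^sub>m ones) = ?X * 1\<^sub>m n - ?X * ((1 / y) \<cdot>\<^sub>m ones)"
      by (rule mult_minus_distrib_mat[OF X]) auto
    moreover have "?X * 1\<^sub>m n = ?X" by (rule right_mult_one_mat[OF X])
    moreover have "?X * ((1 / y) \<cdot>\<^sub>m ones) = (1 / y) \<cdot>\<^sub>m (?X * ones)"
      by (rule mult_smult_distrib[OF X ones_carrier])
    moreover have "?X * ones = x \<cdot>\<^sub>m ones - adj * ones"
      using minus_mult_distrib_mat[of "x \<cdot>\<^sub>m 1\<^sub>m n" n n adj ones n]
        mult_smult_assoc_mat[of "1\<^sub>m n" n n ones n x] left_mult_one_mat[OF ones_carrier] by simp
    moreover have "x \<cdot>\<^sub>m ones - adj * ones = (- y) \<cdot>\<^sub>m ones"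
      unfolding adj_times_ones by (rule eq_matI) (auto simp: ones_def y_def)
    moreover have "?X - (1 / y) \<cdot>\<^sub>m ((- y) \<cdot>\<^sub>m ones) = x \<cdot>\<^sub>m 1\<^sub>m n - (adj - ones)"
      using y by (intro eq_matI) (auto simp: ones_def adj_def)
    ultimately have "x \<cdot>\<^sub>m 1\<^sub>m n - (adj - ones) = ?X * (1\<^sub>m n - (1 / y) \<cdot>\<^sub>m ones)"
      by (simp only:)
    then have "det (x \<cdot>\<^sub>m 1\<^sub>m n - (adj - ones)) = det ?X * det (1\<^sub>m n - (1 / y) \<cdot>\<^sub>m ones)"
      using det_mult[OF X, of "1\<^sub>m n - (1 / y) \<cdot>\<^sub>m ones"] by (simp add: minus_carrier_mat)
    then have "poly (char_poly (adj - ones)) x = poly (char_poly adj) x * ((y - of_nat n) / y)"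
      using poly_char_poly_eq_det[OF minus_carrier_mat[OF ones_carrier], of adj x]
        poly_char_poly_eq_det[OF adj_carrier, of x] det_one_minus_ones[OF y] by simp
    then have "y * poly (char_poly (adj - ones)) x = poly (char_poly adj) x * (y - of_nat n)" using y by simp
    then show ?thesis unfolding y_def by (simp add: algebra_simps)
  qed
  \<comment> \<open>The extra factor vanishes at the one point x = d that \<open>eq\<close> misses.
    Both sides then agree everywhere and the factor can be cancelled as a polynomial.\<close>
  have "poly ([:- of_nat d, 1:] * ?p) x = poly ([:- of_nat d, 1:] * ?q) x" for x
    using eq[of x] by (cases "x = of_nat d") (simp_all add: poly_mult)
  then have "[:- of_nat d, 1:] * ?p = [:- of_nat d, 1:] * ?q"
    by (intro poly_eq_poly_eq_iff[THEN iffD1] ext)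
  then show ?thesis by (subst (asm) mult_cancel_left) auto
qed

text \<open>Let (A - J) f = d f. Summing over all vertices and using regularity gives n times the
  sum of f equal to 0. Hence A f = d f, so f is constant by connectedness, and a nonzero constant
  cannot have sum 0.\<close>

lemma not_eigenvalue_deflated: "poly (char_poly (adj - ones)) (of_nat d) \<noteq> 0"
proof
  assume "poly (char_poly (adj - ones)) (of_nat d) = 0"
  then have "eigenvalue (adj - ones) (of_nat d)"
    by (subst eigenvalue_root_char_poly[of _ n]) (auto intro!: minus_carrier_mat)
  moreover have "adj - ones = mat n n (\<lambda>(i, j). of_bool (E (verts ! i) (verts ! j)) - 1)"
    by (rule eq_matI) (auto simp: adj_def ones_def)
  ultimately have ev: "eigenvalue (mat n n (\<lambda>(i, j). of_bool (E (verts ! i) (verts ! j)) - 1)) (of_nat d :: complex)"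
    by simp
  obtain f :: "'a \<Rightarrow> complex" where f: "\<exists>v\<in>V. f v \<noteq> 0"
    "\<And>v. v \<in> V \<Longrightarrow> (\<Sum>w\<in>V. (of_bool (E v w) - 1) * f w) = of_nat d * f v"
    using eigenfunction[of "\<lambda>u v. of_bool (E u v) - 1" "of_nat d", OF ev] by blast
  have eq: "(\<Sum>w\<in>V. of_bool (E v w) * f w) = of_nat d * f v + sum f V" if "v \<in> V" for v
    using f(2)[OF that] unfolding left_diff_distrib sum_subtractf by (simp add: algebra_simps)
  have "(\<Sum>v\<in>V. \<Sum>w\<in>V. of_bool (E v w) * f w) = (\<Sum>w\<in>V. \<Sum>v\<in>V. of_bool (E w v) * f w)"
    by (subst sum.swap) (use E_sym in \<open>auto intro!: sum.cong simp: of_bool_def\<close>)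
  also have "\<dots> = of_nat d * sum f V" by (simp add: sum_adj sum_distrib_left)
  finally have "of_nat d * sum f V + of_nat n * sum f V = of_nat d * sum f V"
    using eq by (simp add: sum.distrib card_V flip: sum_distrib_left)
  then have z: "sum f V = 0" using n_pos by simp
  from f(1) obtain v where v: "v \<in> V" "f v \<noteq> 0" by blast
  have "f u = f v" if "u \<in> V" for u
    by (rule harmonic_const) (use eq z v that in auto)
  then have "sum f V = of_nat n * f v" using card_V by simp
  with z v n_pos show False by simp
qed

text \<open>At d the left side of \<open>char_poly_adj_deflate\<close> vanishes and the last factor
  on the right is n, so d is a root. After one factor x - d is cancelled, the remaining roots of A
  are roots of A - J, among which d does not occur.\<close>

lemma adj_spectrum:
  obtains ls :: "real list" where
    "char_poly adj = (\<Prod>e\<leftarrow>of_nat d # map of_real ls. [:- e, 1:])" "length ls = n - 1"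
    "\<And>l. l \<in> set ls \<Longrightarrow> l < real d"
proof -
  obtain es where es: "char_poly adj = (\<Prod>e\<leftarrow>es. [:- e, 1:])" "length es = n"
    using char_poly_factorized[OF adj_carrier] by blast
  have rt: "poly (char_poly adj) e = 0 \<longleftrightarrow> e \<in> set es" for e
    unfolding es(1) by (auto simp: poly_prod_list prod_list_zero_iff)
  have "poly (char_poly adj) (of_nat d) * of_nat n = 0"
    using arg_cong[OF char_poly_adj_deflate, of "\<lambda>p. poly p (of_nat d)"]
    by (simp add: algebra_simps)
  then have d: "of_nat d \<in> set es" using rt n_pos by simp
  define es' where "es' = remove1 (of_nat d) es"
  have "mset es = mset (of_nat d # es')" using d by (simp add: es'_def)
  then have prod: "(\<Prod>e\<leftarrow>es. [:- e, 1:]) = (\<Prod>e\<leftarrow>of_nat d # es'. [:- e, 1:])"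
    by (metis (no_types, lifting) mset_map prod_mset_prod_list)
  have "[:- of_nat d, 1:] * char_poly (adj - ones)
      = [:- of_nat d, 1:] * ((\<Prod>e\<leftarrow>es'. [:- e, 1:]) * [:of_nat n - of_nat d, 1:])"
    unfolding char_poly_adj_deflate es(1) prod by (simp only: list.map prod_list.Cons mult.assoc)
  then have "char_poly (adj - ones) = (\<Prod>e\<leftarrow>es'. [:- e, 1:]) * [:of_nat n - of_nat d, 1:]"
    by (subst (asm) mult_cancel_left) auto
  with not_eigenvalue_deflated have "poly (\<Prod>e\<leftarrow>es'. [:- e, 1:]) (of_nat d) \<noteq> 0" by auto
  then have d': "of_nat d \<notin> set es'" by (auto simp: poly_prod_list prod_list_zero_iff)
  have sub: "set es' \<subseteq> set es" unfolding es'_def by (rule set_remove1_subset)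
  have ev: "e \<in> \<real> \<and> Re e < real d" if "e \<in> set es'" for e
  proof -
    have "eigenvalue adj e" using that sub rt eigenvalue_root_char_poly[OF adj_carrier] by auto
    note ev = eigenvalue_adj_real[OF this]
    moreover have "Re e \<noteq> real d" using ev(1) that d' by (metis of_real_Re of_real_of_nat_eq)
    ultimately show ?thesis by auto
  qed
  have m: "map complex_of_real (map Re es') = es'"
    using ev by (auto simp: comp_def intro!: map_idI)
  show ?thesis
  proof (rule that[of "map Re es'"])
    show "char_poly adj = (\<Prod>e\<leftarrow>of_nat d # map of_real (map Re es'). [:- e, 1:])"
      unfolding m es(1) prod ..
    show "length (map Re es') = n - 1" using es(2) d by (simp add: es'_def length_remove1)
  qed (use ev in auto)
qed

section \<open>The walks on arcs\<close>

abbreviation arcl :: "('a \<times> 'a) list" where "arcl \<equiv> arc_list V E"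

abbreviation N :: nat where "N \<equiv> length arcl"

lemma arcs_eq: "arcs V E = {(u, v). E u v}"
  using E_V by (auto simp: arcs_def)

lemma finite_arcs: "finite (arcs V E)"
  by (rule finite_subset[of _ "V \<times> V"]) (auto simp: arcs_def finite_V)

lemma arcl: "distinct arcl" "set arcl = arcs V E"
proof -
  have "\<exists>xs. distinct xs \<and> set xs = arcs V E" using finite_distinct_list[OF finite_arcs] by blast
  from someI_ex[OF this] show "distinct arcl" "set arcl = arcs V E" by (auto simp: arc_list_def)
qed

lemma arcl_E: "i < N \<Longrightarrow> E (fst (arcl ! i)) (snd (arcl ! i))"
  using nth_mem[of i arcl] unfolding arcl(2) arcs_eq by auto

lemma arcl_V: "i < N \<Longrightarrow> fst (arcl ! i) \<in> V" "i < N \<Longrightarrow> snd (arcl ! i) \<in> V"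
  using arcl_E E_V by blast+

lemma arcl_eq_iff: "i < N \<Longrightarrow> j < N \<Longrightarrow> arcl ! i = arcl ! j \<longleftrightarrow> i = j"
  using arcl(1) by (simp add: nth_eq_iff_index_eq)

lemma sum_arcl: "(\<Sum>k<N. f (arcl ! k)) = (\<Sum>a\<in>arcs V E. f a)"
  using sum.reindex_bij_betw[OF bij_betw_nth[OF arcl(1), of "{..<N}" "arcs V E"], of f] arcl(2) by simp

lemma sum_arcs:
  fixes f :: "'a \<times> 'a \<Rightarrow> 'b :: semiring_1"
  shows "(\<Sum>a\<in>arcs V E. f a) = (\<Sum>u\<in>V. \<Sum>w\<in>V. of_bool (E u w) * f (u, w))"
proof -
  have "(\<Sum>u\<in>V. \<Sum>w\<in>V. of_bool (E u w) * f (u, w)) = (\<Sum>a\<in>V \<times> V. of_bool (E (fst a) (snd a)) * f a)"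
    by (simp add: sum.cartesian_product case_prod_unfold)
  also have "\<dots> = (\<Sum>a\<in>arcs V E. f a)"
    by (rule sum.mono_neutral_cong_right) (auto simp: finite_V arcs_def)
  finally show ?thesis by simp
qed

lemma N_eq: "N = n * d"
proof -
  have "N = (\<Sum>a\<in>arcs V E. 1)" using sum_arcl[of "\<lambda>_. 1 :: nat"] by simp
  also have "\<dots> = (\<Sum>u\<in>V. d)" unfolding sum_arcs using sum_adj[of _ "1 :: nat"] by simp
  finally show ?thesis by (simp add: card_V)
qed

lemma sum_V_delta: "x \<in> V \<Longrightarrow> (\<Sum>v\<in>V. of_bool (x = v) * g v) = (g x :: 'b :: semiring_1)"
  using finite_V by (simp add: of_bool_def if_distrib[of "\<lambda>t. t * _"] sum.delta cong: if_cong)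

lemma sum_arcs_delta: "x \<in> arcs V E \<Longrightarrow> (\<Sum>a\<in>arcs V E. of_bool (a = x) * g a) = (g x :: 'b :: semiring_1)"
  using finite_arcs by (simp add: of_bool_def if_distrib[of "\<lambda>t. t * _"] sum.delta' cong: if_cong)

text \<open>As operators on columns, \<open>head_mat\<close> and \<open>tail_mat\<close> pull a
  function on vertices back to arcs along the two endpoint maps, and \<open>out_mat\<close> sums a
  function on arcs over the arcs leaving a vertex.\<close>

definition head_mat :: "complex mat" where
  "head_mat = mat N n (\<lambda>(i, j). of_bool (snd (arcl ! i) = verts ! j))"

definition tail_mat :: "complex mat" where
  "tail_mat = mat N n (\<lambda>(i, j). of_bool (fst (arcl ! i) = verts ! j))"

definition out_mat :: "complex mat" where
  "out_mat = mat n N (\<lambda>(i, j). of_bool (fst (arcl ! j) = verts ! i))"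

definition rev_mat :: "complex mat" where
  "rev_mat = mat N N (\<lambda>(i, j). of_bool (arcl ! j = prod.swap (arcl ! i)))"

text \<open>Every arc may be followed by its own reversal, and this is its only backtracking
  successor. Hence \<open>line_mat - rev_mat\<close> is the non-backtracking (Hashimoto)
  matrix.\<close>

definition line_mat :: "complex mat" where
  "line_mat = mat N N (\<lambda>(i, j). of_bool (snd (arcl ! i) = fst (arcl ! j)))"

lemma mat_carriers [simp]:
  "head_mat \<in> carrier_mat N n" "tail_mat \<in> carrier_mat N n" "out_mat \<in> carrier_mat n N"
  "rev_mat \<in> carrier_mat N N" "line_mat \<in> carrier_mat N N"
  by (auto simp: head_mat_def tail_mat_def out_mat_def rev_mat_def line_mat_def)

lemma mat_dims [simp]:
  "dim_row head_mat = N" "dim_col head_mat = n" "dim_row tail_mat = N" "dim_col tail_mat = n"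
  "dim_row out_mat = n" "dim_col out_mat = N" "dim_row rev_mat = N" "dim_col rev_mat = N"
  "dim_row line_mat = N" "dim_col line_mat = N" "dim_row adj = n" "dim_col adj = n"
  by (auto simp: head_mat_def tail_mat_def out_mat_def rev_mat_def line_mat_def adj_def)

lemma head_mult_out: "head_mat * out_mat = line_mat"
proof (rule eq_matI, goal_cases)
  case (1 i j)
  then have ij: "i < N" "j < N" by auto
  have "(head_mat * out_mat) $$ (i, j)
      = (\<Sum>k<n. of_bool (snd (arcl ! i) = verts ! k) * of_bool (fst (arcl ! j) = verts ! k))"
    unfolding head_mat_def out_mat_def mult_mat_index[OF ij] by simp
  also have "\<dots> = (\<Sum>v\<in>V. of_bool (snd (arcl ! i) = v) * of_bool (fst (arcl ! j) = v))"
    by (rule sum_verts)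
  also have "\<dots> = of_bool (fst (arcl ! j) = snd (arcl ! i))"
    by (rule sum_V_delta[OF arcl_V(2)[OF ij(1)]])
  finally show ?case using ij by (simp add: line_mat_def eq_commute)
qed auto

lemma out_mult_head: "out_mat * head_mat = adj"
proof (rule eq_matI, goal_cases)
  case (1 i j)
  then have ij: "i < n" "j < n" by auto
  have "(out_mat * head_mat) $$ (i, j)
      = (\<Sum>k<N. of_bool (fst (arcl ! k) = verts ! i) * of_bool (snd (arcl ! k) = verts ! j))"
    unfolding head_mat_def out_mat_def mult_mat_index[OF ij] by simp
  also have "\<dots> = (\<Sum>a\<in>arcs V E. of_bool (fst a = verts ! i) * of_bool (snd a = verts ! j))"
    by (rule sum_arcl)
  also have "\<dots> = (\<Sum>u\<in>V. of_bool (verts ! i = u) * (\<Sum>w\<in>V. of_bool (verts ! j = w) * of_bool (E u w)))"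
    unfolding sum_arcs sum_distrib_left by (intro sum.cong refl) auto
  also have "\<dots> = of_bool (E (verts ! i) (verts ! j))"
    using verts_in[OF ij(1)] verts_in[OF ij(2)] by (simp only: sum_V_delta)
  finally show ?case using ij by (simp add: adj_index)
qed auto

lemma out_mult_tail: "out_mat * tail_mat = of_nat d \<cdot>\<^sub>m 1\<^sub>m n"
proof (rule eq_matI, goal_cases)
  case (1 i j)
  then have ij: "i < n" "j < n" by auto
  have "(out_mat * tail_mat) $$ (i, j)
      = (\<Sum>k<N. of_bool (fst (arcl ! k) = verts ! i) * of_bool (fst (arcl ! k) = verts ! j))"
    unfolding tail_mat_def out_mat_def mult_mat_index[OF ij] by simp
  also have "\<dots> = (\<Sum>a\<in>arcs V E. of_bool (fst a = verts ! i) * of_bool (fst a = verts ! j))"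
    by (rule sum_arcl)
  also have "\<dots> = (\<Sum>u\<in>V. of_bool (verts ! i = u) * (\<Sum>w\<in>V. of_bool (E u w) * of_bool (u = verts ! j)))"
    unfolding sum_arcs sum_distrib_left by (intro sum.cong refl) auto
  also have "\<dots> = (\<Sum>w\<in>V. of_bool (E (verts ! i) w) * of_bool (verts ! i = verts ! j))"
    by (rule sum_V_delta[OF verts_in[OF ij(1)]])
  also have "\<dots> = of_nat d * of_bool (verts ! i = verts ! j)"
    by (rule sum_adj[OF verts_in[OF ij(1)]])
  finally show ?case using ij by (simp add: verts_eq_iff)
qed auto

lemma swap_arcl: "i < N \<Longrightarrow> prod.swap (arcl ! i) \<in> arcs V E"
  using arcl_E[of i] E_sym by (auto simp: arcs_eq prod.swap_def)

lemma rev_mult_head: "rev_mat * head_mat = tail_mat"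
proof (rule eq_matI, goal_cases)
  case (1 i j)
  then have ij: "i < N" "j < n" by auto
  have "(rev_mat * head_mat) $$ (i, j)
      = (\<Sum>k<N. of_bool (arcl ! k = prod.swap (arcl ! i)) * of_bool (snd (arcl ! k) = verts ! j))"
    unfolding head_mat_def rev_mat_def mult_mat_index[OF ij] by simp
  also have "\<dots> = (\<Sum>a\<in>arcs V E. of_bool (a = prod.swap (arcl ! i)) * of_bool (snd a = verts ! j))"
    by (rule sum_arcl)
  also have "\<dots> = of_bool (snd (prod.swap (arcl ! i)) = verts ! j)"
    by (rule sum_arcs_delta[OF swap_arcl[OF ij(1)]])
  finally show ?case using ij by (simp add: tail_mat_def)
qed auto

lemma rev_mult_rev: "rev_mat * rev_mat = 1\<^sub>m N"
proof (rule eq_matI, goal_cases)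
  case (1 i j)
  then have ij: "i < N" "j < N" by auto
  have "(rev_mat * rev_mat) $$ (i, j)
      = (\<Sum>k<N. of_bool (arcl ! k = prod.swap (arcl ! i)) * of_bool (arcl ! j = prod.swap (arcl ! k)))"
    unfolding rev_mat_def mult_mat_index[OF ij] by simp
  also have "\<dots> = (\<Sum>a\<in>arcs V E. of_bool (a = prod.swap (arcl ! i)) * of_bool (arcl ! j = prod.swap a))"
    by (rule sum_arcl)
  also have "\<dots> = of_bool (arcl ! j = prod.swap (prod.swap (arcl ! i)))"
    by (rule sum_arcs_delta[OF swap_arcl[OF ij(1)]])
  finally show ?case using ij by (auto simp: arcl_eq_iff)
qed auto

text \<open>Orienting every edge gives a diagonal sign matrix D with D R = - R D, where R is the arc
  reversal; hence z I - R and z I + R have the same determinant.\<close>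

lemma det_rev_pencil: "(det (z \<cdot>\<^sub>m 1\<^sub>m N - rev_mat))\<^sup>2 = (z\<^sup>2 - 1) ^ N"
proof -
  \<comment> \<open>The vertices carry no order, so an injection into the naturals selects one of
    the two arcs of each edge.\<close>
  obtain g :: "'a \<Rightarrow> nat" where g: "inj_on g V"
    using finite_imp_inj_to_nat_seg[OF finite_V] by blast
  define s :: "nat \<Rightarrow> complex"
    where "s i = (if g (fst (arcl ! i)) < g (snd (arcl ! i)) then 1 else - 1)" for i
  have s2: "s i * s i = 1" for i by (simp add: s_def)
  have flip: "s j = - s i" if "i < N" "j < N" "arcl ! j = prod.swap (arcl ! i)" for i j
  proof -
    have "fst (arcl ! i) \<noteq> snd (arcl ! i)" using arcl_E[OF that(1)] E_irrefl by metis
    then have "g (fst (arcl ! i)) \<noteq> g (snd (arcl ! i))"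
      using g arcl_V[OF that(1)] by (auto dest: inj_onD)
    then show ?thesis using that(3) by (auto simp: s_def)
  qed
  define D where "D = mat N N (\<lambda>(i, j). if i = j then s i else 0)"
  let ?X = "z \<cdot>\<^sub>m 1\<^sub>m N - rev_mat" and ?Y = "z \<cdot>\<^sub>m 1\<^sub>m N + rev_mat"
  have D: "D \<in> carrier_mat N N" by (simp add: D_def)
  have X: "?X \<in> carrier_mat N N" by (rule minus_carrier_mat) simp
  have Y: "?Y \<in> carrier_mat N N" by simp
  have DX: "D * ?X = mat N N (\<lambda>(i, j). s i * ?X $$ (i, j))"
  proof (rule eq_matI, goal_cases)
    case (1 i j)
    then have ij: "i < N" "j < N" by auto
    have "(D * ?X) $$ (i, j) = (\<Sum>k<N. D $$ (i, k) * ?X $$ (k, j))"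
      using ij D by (auto simp: scalar_prod_def lessThan_atLeast0 intro!: sum.cong)
    also have "\<dots> = (\<Sum>k\<in>{i}. D $$ (i, k) * ?X $$ (k, j))"
      by (rule sum.mono_neutral_right) (use ij in \<open>auto simp: D_def\<close>)
    finally show ?case using ij by (simp add: D_def)
  qed (use D in auto)
  have YD: "?Y * D = mat N N (\<lambda>(i, j). ?Y $$ (i, j) * s j)"
  proof (rule eq_matI, goal_cases)
    case (1 i j)
    then have ij: "i < N" "j < N" by auto
    have "(?Y * D) $$ (i, j) = (\<Sum>k<N. ?Y $$ (i, k) * D $$ (k, j))"
      using ij D by (auto simp: scalar_prod_def lessThan_atLeast0 intro!: sum.cong)
    also have "\<dots> = (\<Sum>k\<in>{j}. ?Y $$ (i, k) * D $$ (k, j))"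
      by (rule sum.mono_neutral_right) (use ij in \<open>auto simp: D_def\<close>)
    finally show ?case using ij by (simp add: D_def)
  qed (use D in auto)
  have "D * ?X = ?Y * D"
    unfolding DX YD
  proof (rule eq_matI, goal_cases)
    case (1 i j)
    then have ij: "i < N" "j < N" by auto
    show ?case
    proof (cases "arcl ! j = prod.swap (arcl ! i)")
      case True
      from flip[OF ij True] have sj: "s j = - s i" .
      moreover have "i \<noteq> j" using sj s2[of i] by auto
      ultimately show ?thesis using ij True by (simp add: rev_mat_def)
    next
      case False
      then show ?thesis using ij by (simp add: rev_mat_def)
    qed
  qed auto
  then have "det D * det ?X = det ?Y * det D"
    using det_mult[OF D X] det_mult[OF Y D] by metis
  moreover have "det D \<noteq> 0"
  proof -
    have "det D = prod_list (diag_mat D)"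
      by (rule det_upper_triangular[OF _ D]) (auto simp: D_def)
    then show ?thesis by (auto simp: diag_mat_def D_def s_def split: if_splits)
  qed
  ultimately have XY: "det ?X = det ?Y" by simp
  have "?X * ?Y = (z\<^sup>2 - 1) \<cdot>\<^sub>m 1\<^sub>m N"
  proof -
    have 1: "?X * ?Y = ?X * (z \<cdot>\<^sub>m 1\<^sub>m N) + ?X * rev_mat"
      by (rule mult_add_distrib_mat[OF X]) auto
    have 2: "?X * (z \<cdot>\<^sub>m 1\<^sub>m N) = z \<cdot>\<^sub>m ?X"
      using mult_smult_distrib[OF X one_carrier_mat, of z] right_mult_one_mat[OF X] by simp
    have 3: "?X * rev_mat = z \<cdot>\<^sub>m rev_mat - rev_mat * rev_mat"
      using minus_mult_distrib_mat[of "z \<cdot>\<^sub>m 1\<^sub>m N" N N rev_mat rev_mat N]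
        mult_smult_assoc_mat[of "1\<^sub>m N" N N rev_mat N z] left_mult_one_mat[of rev_mat N N] by simp
    show ?thesis unfolding 1 2 3 rev_mult_rev
      by (rule eq_matI) (auto simp: power2_eq_square algebra_simps)
  qed
  then have "det ?X * det ?Y = (z\<^sup>2 - 1) ^ N" using det_mult[OF X Y] by simp
  then show ?thesis using XY by (simp add: power2_eq_square)
qed

text \<open>The factor z I - R makes the two terms linear in the reversal R cancel, and R^2 = I.
  What remains is a scalar matrix minus a product that passes through the n vertices, to which
  \<open>char_poly_mult_swap\<close> applies.\<close>

lemma rev_pencil_mult_nb_pencil:
  "(z \<cdot>\<^sub>m 1\<^sub>m N - rev_mat) * (z \<cdot>\<^sub>m 1\<^sub>m N - (line_mat - rev_mat))
     = (z\<^sup>2 - 1) \<cdot>\<^sub>m 1\<^sub>m N - (z \<cdot>\<^sub>m head_mat - tail_mat) * out_mat"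
proof -
  let ?X = "z \<cdot>\<^sub>m 1\<^sub>m N - rev_mat" and ?B = "line_mat - rev_mat"
  have X: "?X \<in> carrier_mat N N" and B: "?B \<in> carrier_mat N N"
    by (rule minus_carrier_mat, simp)+
  have T: "tail_mat * out_mat \<in> carrier_mat N N" by (rule mult_carrier_mat[of _ N n]) auto
  have "rev_mat * line_mat = tail_mat * out_mat"
    unfolding head_mult_out[symmetric]
    using assoc_mult_mat[of rev_mat N N head_mat n out_mat N] rev_mult_head by simp
  then have RB: "rev_mat * ?B = tail_mat * out_mat - 1\<^sub>m N"
    using mult_minus_distrib_mat[of rev_mat N N line_mat N rev_mat] rev_mult_rev by simp
  have XB: "?X * ?B = z \<cdot>\<^sub>m ?B - rev_mat * ?B"
    using minus_mult_distrib_mat[of "z \<cdot>\<^sub>m 1\<^sub>m N" N N rev_mat ?B N] B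
      mult_smult_assoc_mat[of "1\<^sub>m N" N N ?B N z] left_mult_one_mat[OF B] by simp
  have "?X * (z \<cdot>\<^sub>m 1\<^sub>m N - ?B) = ?X * (z \<cdot>\<^sub>m 1\<^sub>m N) - ?X * ?B"
    by (rule mult_minus_distrib_mat[OF X _ B]) simp
  also have "?X * (z \<cdot>\<^sub>m 1\<^sub>m N) = z \<cdot>\<^sub>m ?X"
    using mult_smult_distrib[OF X one_carrier_mat, of z] right_mult_one_mat[OF X] by simp
  finally have L: "?X * (z \<cdot>\<^sub>m 1\<^sub>m N - ?B) = z \<cdot>\<^sub>m ?X - (z \<cdot>\<^sub>m ?B - (tail_mat * out_mat - 1\<^sub>m N))"
    unfolding XB RB .
  have R: "(z \<cdot>\<^sub>m head_mat - tail_mat) * out_mat = z \<cdot>\<^sub>m line_mat - tail_mat * out_mat"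
    using minus_mult_distrib_mat[of "z \<cdot>\<^sub>m head_mat" N n tail_mat out_mat N]
      mult_smult_assoc_mat[of head_mat N n out_mat N z] head_mult_out by simp
  show ?thesis unfolding L R
    by (rule eq_matI) (use T in \<open>auto simp: power2_eq_square algebra_simps simp del: index_mult_mat(1)\<close>)
qed

text \<open>The usual form has the factor z^2 - 1 to the power N / 2 - n. Squaring clears the half,
  and moving powers to both sides keeps the identity valid at the zeros of z^2 - 1.\<close>

lemma ihara_bass:
  assumes es: "char_poly adj = (\<Prod>e\<leftarrow>es. [:- e, 1:])" "length es = n"
  shows "(det (z \<cdot>\<^sub>m 1\<^sub>m N - (line_mat - rev_mat)))\<^sup>2 * (z\<^sup>2 - 1) ^ (2 * n + N)
    = (z\<^sup>2 - 1) ^ (2 * N) * (\<Prod>e\<leftarrow>es. z\<^sup>2 - 1 + of_nat d - z * e)\<^sup>2"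
proof -
  define y where "y = z\<^sup>2 - 1"
  let ?X = "z \<cdot>\<^sub>m 1\<^sub>m N - rev_mat" and ?Y = "z \<cdot>\<^sub>m 1\<^sub>m N - (line_mat - rev_mat)"
  let ?M = "z \<cdot>\<^sub>m head_mat - tail_mat"
  have X: "?X \<in> carrier_mat N N" by (rule minus_carrier_mat) simp
  have Y: "?Y \<in> carrier_mat N N" by (rule minus_carrier_mat, rule minus_carrier_mat) simp
  have M: "?M \<in> carrier_mat N n" by (rule minus_carrier_mat) simp
  have out: "out_mat \<in> carrier_mat n N" by simp
  have "det ?X * det ?Y = det (y \<cdot>\<^sub>m 1\<^sub>m N - ?M * out_mat)"
    using det_mult[OF X Y] unfolding rev_pencil_mult_nb_pencil y_def by simp
  also have "\<dots> = poly (char_poly (?M * out_mat)) y"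
    by (rule poly_char_poly_eq_det[symmetric]) (rule mult_carrier_mat[OF M out])
  finally have "det ?X * det ?Y * y ^ n = poly (char_poly (?M * out_mat) * [:0, 1:] ^ n) y"
    by simp
  also have "\<dots> = y ^ N * poly (char_poly (out_mat * ?M)) y"
    unfolding char_poly_mult_swap[OF M out] by simp
  also have "poly (char_poly (out_mat * ?M)) y = det (y \<cdot>\<^sub>m 1\<^sub>m n - out_mat * ?M)"
    by (rule poly_char_poly_eq_det) (rule mult_carrier_mat[OF out M])
  also have "out_mat * ?M = z \<cdot>\<^sub>m adj - of_nat d \<cdot>\<^sub>m 1\<^sub>m n"
    using mult_minus_distrib_mat[OF out, of "z \<cdot>\<^sub>m head_mat" n tail_mat]
      mult_smult_distrib[OF out, of head_mat n z] out_mult_head out_mult_tail by simp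
  also have "y \<cdot>\<^sub>m 1\<^sub>m n - (z \<cdot>\<^sub>m adj - of_nat d \<cdot>\<^sub>m 1\<^sub>m n) = (y + of_nat d) \<cdot>\<^sub>m 1\<^sub>m n - z \<cdot>\<^sub>m adj"
    by (rule eq_matI) (auto simp: algebra_simps)
  also have "det \<dots> = (\<Prod>e\<leftarrow>es. y + of_nat d - z * e)"
    by (rule det_pencil[OF adj_carrier es])
  finally have "(det ?X * det ?Y * y ^ n)\<^sup>2 = (y ^ N * (\<Prod>e\<leftarrow>es. y + of_nat d - z * e))\<^sup>2" by simp
  then have "(det ?X)\<^sup>2 * (det ?Y)\<^sup>2 * (y ^ n)\<^sup>2 = (y ^ N)\<^sup>2 * (\<Prod>e\<leftarrow>es. y + of_nat d - z * e)\<^sup>2"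
    by (simp only: power_mult_distrib)
  then have "(det ?Y)\<^sup>2 * y ^ (2 * n + N) = y ^ (2 * N) * (\<Prod>e\<leftarrow>es. y + of_nat d - z * e)\<^sup>2"
    unfolding det_rev_pencil y_def[symmetric]
    unfolding power_add power_even_eq by (simp only: mult_ac)
  then show ?thesis by (simp add: y_def)
qed

section \<open>Bounds for the spectral sum\<close>

text \<open>The trace of A^3, that is, six times the number of triangles.\<close>

definition closed_triples :: real where
  "closed_triples = (\<Sum>u\<in>V. \<Sum>w\<in>V. \<Sum>x\<in>V. of_bool (E u x) * of_bool (E x w) * of_bool (E w u))"

lemma adj_sq_index:
  assumes "i < n" "j < n"
  shows "(adj * adj) $$ (i, j) = (\<Sum>x\<in>V. of_bool (E (verts ! i) x) * of_bool (E x (verts ! j)))"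
proof -
  have "(adj * adj) $$ (i, j) = (\<Sum>k<n. of_bool (E (verts ! i) (verts ! k)) * of_bool (E (verts ! k) (verts ! j)))"
    unfolding adj_def mult_mat_index[OF assms] by simp
  also have "\<dots> = (\<Sum>x\<in>V. of_bool (E (verts ! i) x) * of_bool (E x (verts ! j)))"
    by (rule sum_verts)
  finally show ?thesis .
qed

lemma trace_adj: "(\<Sum>i<n. adj $$ (i, i)) = 0"
  by (simp add: adj_index E_irrefl)

lemma trace_adj_sq: "(\<Sum>i<n. (adj * adj) $$ (i, i)) = of_nat (n * d)"
proof -
  have "(adj * adj) $$ (i, i) = of_nat d" if "i < n" for i
  proof -
    have "(adj * adj) $$ (i, i) = (\<Sum>x\<in>V. of_bool (E (verts ! i) x) * 1)"
      unfolding adj_sq_index[OF that that] using E_sym by (intro sum.cong refl) auto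
    then show ?thesis using sum_adj[OF verts_in[OF that], of "1 :: complex"] by simp
  qed
  then show ?thesis by simp
qed

lemma trace_adj_cube: "(\<Sum>i<n. (adj * adj * adj) $$ (i, i)) = of_real closed_triples"
proof -
  have "(adj * adj * adj) $$ (i, i)
      = (\<Sum>w\<in>V. \<Sum>x\<in>V. of_bool (E (verts ! i) x) * of_bool (E x w) * of_bool (E w (verts ! i)))"
    if i: "i < n" for i
  proof -
    have "(adj * adj * adj) $$ (i, i) = (\<Sum>k<n. (adj * adj) $$ (i, k) * adj $$ (k, i))"
      using i by (simp add: scalar_prod_def lessThan_atLeast0 adj_def)
    also have "\<dots> = (\<Sum>k<n. (\<Sum>x\<in>V. of_bool (E (verts ! i) x) * of_bool (E x (verts ! k))) * of_bool (E (verts ! k) (verts ! i)))"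
      using i by (intro sum.cong refl) (simp add: adj_sq_index adj_index del: index_mult_mat)
    also have "\<dots> = (\<Sum>w\<in>V. (\<Sum>x\<in>V. of_bool (E (verts ! i) x) * of_bool (E x w)) * of_bool (E w (verts ! i)))"
      by (rule sum_verts)
    finally show ?thesis by (simp only: sum_distrib_right)
  qed
  then have "(\<Sum>i<n. (adj * adj * adj) $$ (i, i))
      = (\<Sum>i<n. \<Sum>w\<in>V. \<Sum>x\<in>V. of_bool (E (verts ! i) x) * of_bool (E x w) * of_bool (E w (verts ! i)))"
    by (intro sum.cong refl) auto
  also have "\<dots> = (\<Sum>u\<in>V. \<Sum>w\<in>V. \<Sum>x\<in>V. of_bool (E u x) * of_bool (E x w) * of_bool (E w u))"
    by (rule sum_verts)
  moreover have "complex_of_real (of_bool b) = of_bool b" for b by (cases b) auto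
  ultimately show ?thesis by (simp only: closed_triples_def of_real_sum of_real_mult)
qed

lemma spectral_moments:
  assumes ls: "char_poly adj = (\<Prod>e\<leftarrow>of_nat d # map of_real ls. [:- e, 1:])"
  shows "sum_list ls = - real d" "(\<Sum>l\<leftarrow>ls. l ^ 2) = real n * real d - real d ^ 2"
    "(\<Sum>l\<leftarrow>ls. l ^ 3) = closed_triples - real d ^ 3"
proof -
  have of_real: "(\<Sum>l\<leftarrow>ls. complex_of_real l ^ k) = of_real (\<Sum>l\<leftarrow>ls. l ^ k)" for k
    by (induction ls) auto
  have m: "(\<Sum>i<n. (adj ^\<^sub>m k) $$ (i, i)) = of_real (real d ^ k + (\<Sum>l\<leftarrow>ls. l ^ k))" for k
    using trace_pow_eq_sum_eigenvalues[OF adj_carrier ls, of k] of_real[of k] by (simp add: comp_def)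
  have p: "adj ^\<^sub>m 1 = adj" "adj ^\<^sub>m 2 = adj * adj" "adj ^\<^sub>m 3 = adj * adj * adj"
    using left_mult_one_mat[OF adj_carrier] by (simp_all add: numeral_2_eq_2 numeral_3_eq_3)
  have "complex_of_real (real d ^ 1 + (\<Sum>l\<leftarrow>ls. l ^ 1)) = of_real 0"
    using m[of 1] unfolding p trace_adj by simp
  then have "real d ^ 1 + (\<Sum>l\<leftarrow>ls. l ^ 1) = 0" unfolding of_real_eq_iff .
  then show "sum_list ls = - real d" by simp
  have "complex_of_real (real d ^ 2 + (\<Sum>l\<leftarrow>ls. l ^ 2)) = of_real (real n * real d)"
    using m[of 2] unfolding p trace_adj_sq by simp
  then have "real d ^ 2 + (\<Sum>l\<leftarrow>ls. l ^ 2) = real n * real d" unfolding of_real_eq_iff .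
  then show "(\<Sum>l\<leftarrow>ls. l ^ 2) = real n * real d - real d ^ 2" by simp
  have "complex_of_real (real d ^ 3 + (\<Sum>l\<leftarrow>ls. l ^ 3)) = of_real closed_triples"
    using m[of 3] unfolding p trace_adj_cube by simp
  then have "real d ^ 3 + (\<Sum>l\<leftarrow>ls. l ^ 3) = closed_triples" unfolding of_real_eq_iff .
  then show "(\<Sum>l\<leftarrow>ls. l ^ 3) = closed_triples - real d ^ 3" by simp
qed

lemma closed_triples_pos:
  assumes "E u v" "E v w" "E w u"
  shows "closed_triples > 0"
proof -
  let ?f = "\<lambda>u w x. of_bool (E u x) * of_bool (E x w) * of_bool (E w u) :: real"
  have V: "u \<in> V" "v \<in> V" "w \<in> V" using assms E_V by auto
  have "0 < ?f u w v" using assms by simp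
  also have "\<dots> \<le> (\<Sum>x\<in>V. ?f u w x)"
    by (rule member_le_sum[of v V "?f u w"]) (use V finite_V in auto)
  also have "\<dots> \<le> (\<Sum>w\<in>V. \<Sum>x\<in>V. ?f u w x)"
    by (rule member_le_sum[of w V "\<lambda>w. \<Sum>x\<in>V. ?f u w x"]) (use V finite_V in \<open>auto intro!: sum_nonneg\<close>)
  also have "\<dots> \<le> closed_triples"
    unfolding closed_triples_def
    by (rule member_le_sum[of u V "\<lambda>u. \<Sum>w\<in>V. \<Sum>x\<in>V. ?f u w x"]) (use V finite_V in \<open>auto intro!: sum_nonneg\<close>)
  finally show ?thesis .
qed

section \<open>Recognising the small graphs by counting neighbours\<close>

lemma neighbours: "v \<in> V \<Longrightarrow> card {w. E v w} = d" "finite {w. E v w}" "{w. E v w} \<subseteq> V - {v}"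
proof -
  show sub: "{w. E v w} \<subseteq> V - {v}" using E_V E_irrefl by auto
  then show "finite {w. E v w}" using finite_V finite_subset by blast
  have "{w \<in> V. E v w} = {w. E v w}" using sub by auto
  then show "v \<in> V \<Longrightarrow> card {w. E v w} = d" using reg by (auto simp: regular_def degree_def)
qed

lemma V_nonempty: "V \<noteq> {}"
  using conn by (auto simp: connected_graph_def)

lemma degree_less: "d < n"
proof -
  obtain v where v: "v \<in> V" using V_nonempty by blast
  have "d \<le> card (V - {v})" using neighbours[of v] v finite_V card_mono[of "V - {v}" "{w. E v w}"] by auto
  also have "\<dots> < card V" using v finite_V by (intro psubset_card_mono) auto
  finally show ?thesis by (simp add: card_V)
qed

lemma complete_iso:
  assumes "n = d + 1"
  shows "graph_iso V E (K_verts n) K_adj"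
proof -
  have adj: "E u v \<longleftrightarrow> u \<noteq> v" if "u \<in> V" "v \<in> V" for u v
  proof -
    have "{w. E u w} = V - {u}"
      by (rule card_subset_eq) (use that finite_V neighbours[of u] assms card_V in auto)
    then show ?thesis using that by auto
  qed
  obtain f where f: "bij_betw f V {0..<n}"
    using ex_bij_betw_finite_nat[OF finite_V] unfolding card_V by blast
  then have "inj_on f V" by (simp add: bij_betw_def)
  then have "\<forall>u\<in>V. \<forall>v\<in>V. E u v \<longleftrightarrow> K_adj (f u) (f v)"
    by (auto simp: adj K_adj_def inj_on_eq_iff)
  then show ?thesis using f unfolding graph_iso_def K_verts_def by blast
qed

text \<open>Reversal pairs the arcs along which \<open>g\<close> increases with those along which it
  decreases, and no arc belongs to both kinds.\<close>

lemma even_nd: "even (n * d)"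
proof -
  obtain g :: "'a \<Rightarrow> nat" where g: "inj_on g V"
    using finite_imp_inj_to_nat_seg[OF finite_V] by blast
  define A where "A = {a \<in> arcs V E. g (fst a) < g (snd a)}"
  have ne: "g u \<noteq> g v" if "E u v" for u v
    using that g E_V[OF that] E_irrefl by (metis inj_onD)
  have un: "arcs V E = A \<union> prod.swap ` A"
  proof (rule Set.set_eqI)
    fix a :: "'a \<times> 'a"
    obtain u v where a: "a = (u, v)" by (cases a)
    have "a \<in> prod.swap ` A \<longleftrightarrow> (v, u) \<in> A" unfolding a by force
    then show "a \<in> arcs V E \<longleftrightarrow> a \<in> A \<union> prod.swap ` A"
      using ne[of u v] E_sym[of u v] E_sym[of v u] unfolding a A_def arcs_eq by auto
  qed
  have disj: "A \<inter> prod.swap ` A = {}" by (auto simp: A_def)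
  have "finite A" using finite_arcs by (simp add: A_def)
  then have "card (arcs V E) = card A + card (prod.swap ` A)"
    unfolding un using disj by (intro card_Un_disjoint) auto
  also have "card (prod.swap ` A) = card A" by (rule card_image) (auto intro: inj_onI)
  finally have "even (card (arcs V E))" by simp
  moreover have "card (arcs V E) = n * d" using distinct_card[OF arcl(1)] arcl(2) N_eq by simp
  ultimately show ?thesis by simp
qed

text \<open>The neighbourhoods \<open>A\<close> of u and \<open>B\<close> of an adjacent vertex v
  are disjoint, since a common neighbour would close a triangle, and 3 + 3 = 6 makes them exhaust
  \<open>V\<close>. An edge inside \<open>A\<close> or inside \<open>B\<close> would form a triangle
  with u or v, so by degree every vertex of one part is joined to the whole other part.\<close>

lemma triangle_free_iso_K33:
  assumes "n = 6" "d = 3" and free: "\<And>u v w. E u v \<Longrightarrow> E v w \<Longrightarrow> \<not> E w u"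
  shows "graph_iso V E K33_verts K33_adj"
proof -
  obtain u where u: "u \<in> V" using V_nonempty by blast
  define A where "A = {w. E u w}"
  have A: "card A = 3" "finite A" "A \<subseteq> V" using neighbours[of u] u assms by (auto simp: A_def)
  then obtain v where v: "v \<in> A" by fastforce
  then have vV: "v \<in> V" using A by auto
  define B where "B = {w. E v w}"
  have B: "card B = 3" "finite B" "B \<subseteq> V" using neighbours[of v] vV assms by (auto simp: B_def)
  have disj: "A \<inter> B = {}" using v free[of u v] E_sym[of u] unfolding A_def B_def by blast
  have un: "A \<union> B = V"
    by (rule card_subset_eq) (use A B disj finite_V assms card_V in \<open>auto simp: card_Un_disjoint\<close>)
  have nA: "{y. E x y} = B" if "x \<in> A" for x
  proof (rule card_subset_eq)
    have "\<not> E x y" if "y \<in> A" for y using that \<open>x \<in> A\<close> free[of u x y] E_sym[of u y] unfolding A_def by blast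
    then show "{y. E x y} \<subseteq> B" using un E_V by blast
    show "card {y. E x y} = card B" using neighbours(1)[of x] that A B assms by auto
  qed (use B in auto)
  have nB: "{y. E x y} = A" if "x \<in> B" for x
  proof (rule card_subset_eq)
    have "\<not> E x y" if "y \<in> B" for y using that \<open>x \<in> B\<close> free[of v x y] E_sym[of v y] unfolding B_def by blast
    then show "{y. E x y} \<subseteq> A" using un E_V by blast
    show "card {y. E x y} = card A" using neighbours(1)[of x] that A B assms by auto
  qed (use A in auto)
  obtain g :: "'a \<Rightarrow> nat" where g: "bij_betw g A {0..<3}" using ex_bij_betw_finite_nat[OF A(2)] A(1) by auto
  obtain h :: "'a \<Rightarrow> nat" where h: "bij_betw h B {0..<3}" using ex_bij_betw_finite_nat[OF B(2)] B(1) by auto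
  define f where "f x = (if x \<in> A then g x else 3 + h x)" for x
  have "bij_betw f A {0..<3}" using g by (subst bij_betw_cong[of A f g]) (auto simp: f_def)
  moreover have "bij_betw f B {3..<6}"
  proof -
    have "bij_betw (\<lambda>k. 3 + k) {0..<3} {3..<6::nat}"
      by (rule bij_betw_byWitness[where f' = "\<lambda>k. k - 3"]) auto
    from bij_betw_trans[OF h this] have "bij_betw (\<lambda>x. 3 + h x) B {3..<6}" by (simp add: comp_def)
    then show ?thesis using disj by (subst bij_betw_cong[of B f "\<lambda>x. 3 + h x"]) (auto simp: f_def)
  qed
  ultimately have "bij_betw f (A \<union> B) ({0..<3} \<union> {3..<6})" by (rule bij_betw_combine) auto
  moreover have "{0..<3} \<union> {3..<6} = K33_verts" by (auto simp: K33_verts_def)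
  ultimately have bij: "bij_betw f V K33_verts" using un by simp
  have less: "f x < 3 \<longleftrightarrow> x \<in> A" if "x \<in> V" for x
    using g that unfolding f_def bij_betw_def by auto
  have "E x y \<longleftrightarrow> K33_adj (f x) (f y)" if "x \<in> V" "y \<in> V" for x y
  proof -
    have "E x y \<longleftrightarrow> (x \<in> A \<longleftrightarrow> y \<in> B)" using that un disj nA nB by blast
    also have "\<dots> \<longleftrightarrow> K33_adj (f x) (f y)"
      using less[OF that(1)] less[OF that(2)] that un disj by (auto simp: K33_adj_def)
    finally show ?thesis .
  qed
  then show ?thesis using bij unfolding graph_iso_def by blast
qed

lemma of_nat_n_minus_1: "real (n - 1) = real n - 1"
  using n_pos of_nat_diff[of 1 n, where 'a = real] by linarith

end

theorem theorem3p4: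
  fixes V :: "'a set" and E :: "'a \<Rightarrow> 'a \<Rightarrow> bool" and d :: nat
  assumes "simple_graph V E"
    and "connected_graph V E"
    and "regular V E d"
    and "d \<ge> 3"
    and "\<not> graph_iso V E (K_verts 4) K_adj"
    and "\<not> graph_iso V E (K_verts 5) K_adj"
    and "\<not> graph_iso V E K33_verts K33_adj"
  shows "1 - 2 / real d < kemeny_nb V E / kemeny_e V E
       \<and> kemeny_nb V E / kemeny_e V E < 1"
proof -
  interpret connected_regular_graph V E d by (rule connected_regular_graph.intro) (fact assms)+
  note d = assms(4) and K4 = assms(5) and K5 = assms(6) and K33 = assms(7)
  obtain ls :: "real list" where
    ls: "char_poly adj = (\<Prod>e\<leftarrow>of_nat d # map of_real ls. [:- e, 1:])" "length ls = n - 1"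
    and bd: "\<And>l. l \<in> set ls \<Longrightarrow> l < real d"
    using adj_spectrum by blast
  have d0: "d > 0" using d by simp
  have kemeny_e_eq: "kemeny_e V E = real n * (real d - 1) + (\<Sum>l\<leftarrow>ls. real d / (real d - l))"
  proof -
    let ?es = "of_nat d # map complex_of_real ls" and ?c = "1 / of_nat d :: complex"
    have len: "length ?es = n" using ls(2) n_pos by simp
    have P: "edge_walk_matrix V E = (?c \<cdot>\<^sub>m head_mat) * out_mat"
    proof -
      have "edge_walk_matrix V E = ?c \<cdot>\<^sub>m line_mat"
        using reg arcl_V
        by (intro eq_matI) (auto simp: edge_walk_matrix_def line_mat_def Let_def regular_def)
      then show ?thesis
        using mult_smult_assoc_mat[of head_mat N n out_mat N ?c] head_mult_out by simp
    qed
    \<comment> \<open>Besides the eigenvalues of A / d the walk has N - n = n (d - 1) zero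
      eigenvalues, and each of them contributes 1 to the root sum.\<close>
    have sw: "char_poly (edge_walk_matrix V E) * [:0, 1:] ^ n = [:0, 1:] ^ N * char_poly (?c \<cdot>\<^sub>m adj)"
      unfolding P using char_poly_mult_swap[of "?c \<cdot>\<^sub>m head_mat" N n out_mat]
        mult_smult_distrib[of out_mat n N head_mat n ?c] out_mult_head by simp
    have A: "char_poly (?c \<cdot>\<^sub>m adj) = (\<Prod>e\<leftarrow>?es. [:- (?c * e), 1:])"
    proof (intro poly_eq_poly_eq_iff[THEN iffD1] ext)
      fix x
      have ev: "poly (\<Prod>e\<leftarrow>es. [:- (?c * e), 1:]) x = (\<Prod>e\<leftarrow>es. x - ?c * e)" for es
        by (induction es) (auto simp: algebra_simps)
      have "poly (char_poly (?c \<cdot>\<^sub>m adj)) x = det (x \<cdot>\<^sub>m 1\<^sub>m n - ?c \<cdot>\<^sub>m adj)"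
        by (rule poly_char_poly_eq_det) simp
      also have "\<dots> = (\<Prod>e\<leftarrow>?es. x - ?c * e)" by (rule det_pencil[OF adj_carrier ls(1) len])
      finally show "poly (char_poly (?c \<cdot>\<^sub>m adj)) x = poly (\<Prod>e\<leftarrow>?es. [:- (?c * e), 1:]) x"
        using ev[of ?es] by simp
    qed
    have nz: "char_poly (edge_walk_matrix V E) \<noteq> 0"
    proof -
      have "edge_walk_matrix V E \<in> carrier_mat N N" by (simp add: edge_walk_matrix_def Let_def)
      from degree_monic_char_poly[OF this] show ?thesis by auto
    qed
    have rA: "root_sum (char_poly (?c \<cdot>\<^sub>m adj)) = (\<Sum>e\<leftarrow>?es. 1 / (1 - ?c * e))"
      unfolding A by (subst root_sum_prod_list) (auto simp: root_sum_linear comp_def simp del: list.map)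
    have nzA: "char_poly (?c \<cdot>\<^sub>m adj) \<noteq> 0"
      unfolding A by (auto simp: prod_list_zero_iff simp del: list.map)
    have r0: "root_sum [:0, 1:] = 1" using root_sum_linear[of 0] by simp
    have "root_sum (char_poly (edge_walk_matrix V E)) + of_nat n = of_nat N + root_sum (char_poly (?c \<cdot>\<^sub>m adj))"
      using arg_cong[OF sw, of root_sum] nz nzA by (simp add: root_sum_mult root_sum_power r0)
    then have "root_sum (char_poly (edge_walk_matrix V E)) = of_nat N - of_nat n + (\<Sum>e\<leftarrow>?es. 1 / (1 - ?c * e))"
      unfolding rA by (simp add: algebra_simps)
    \<comment> \<open>The leading entry d of \<open>?es\<close> gives 1 / (1 - 1), which is 0 by
      convention and drops out.\<close>
    also have "(\<Sum>e\<leftarrow>?es. 1 / (1 - ?c * e)) = of_real (\<Sum>l\<leftarrow>ls. real d / (real d - l))"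
    proof -
      have "1 / (1 - ?c * of_real l) = complex_of_real (real d / (real d - l))" for l
      proof -
        have "1 - ?c * of_real l = complex_of_real ((real d - l) / real d)" using d0 by (simp add: field_simps)
        then show ?thesis by (simp only:) (simp add: divide_simps)
      qed
      then have "(\<Sum>l\<leftarrow>ls. 1 / (1 - ?c * of_real l)) = (\<Sum>l\<leftarrow>ls. complex_of_real (real d / (real d - l)))" by simp
      also have "\<dots> = of_real (\<Sum>l\<leftarrow>ls. real d / (real d - l))" by (induction ls) auto
      finally show ?thesis using d0 by (simp add: comp_def)
    qed
    finally have "Re (root_sum (char_poly (edge_walk_matrix V E)))
        = Re (of_nat N - of_nat n + of_real (\<Sum>l\<leftarrow>ls. real d / (real d - l)))" by (rule arg_cong)
    then show ?thesis
      unfolding kemeny_e_def kemeny_eq_root_sum by (simp add: N_eq algebra_simps)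
  qed
  have kemeny_nb_eq: "kemeny_nb V E = real n * (real d - 1)\<^sup>2 / real d + (real d - 1) / (real d - 2)
    + (\<Sum>l\<leftarrow>ls. (2 * (real d - 1) - l) / (real d - l))"
  proof -
    let ?es = "of_nat d # map complex_of_real ls"
    define r where "r = real d - 1"
    define q where "q = complex_of_real r"
    have r: "r \<ge> 2" using d by (simp add: r_def)
    have dq: "of_nat d = q + 1" by (simp add: q_def r_def)
    have q0: "q \<noteq> 0" using r by (simp add: q_def)
    have len: "length ?es = n" using ls(2) n_pos by simp
    let ?P = "nb_walk_matrix V E" and ?B = "line_mat - rev_mat"
    have B: "?B \<in> carrier_mat N N" by (rule minus_carrier_mat) simp
    have Pc: "?P \<in> carrier_mat N N" by (simp add: nb_walk_matrix_def Let_def)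
    have P: "?P = (1 / q) \<cdot>\<^sub>m ?B"
    proof (rule eq_matI, goal_cases)
      case (1 i j)
      then have ij: "i < N" "j < N" by auto
      have deg: "degree V E (snd (arcl ! i)) = d" using reg arcl_V(2)[OF ij(1)] by (auto simp: regular_def)
      have sw: "arcl ! j = prod.swap (arcl ! i) \<longleftrightarrow> fst (arcl ! j) = snd (arcl ! i) \<and> snd (arcl ! j) = fst (arcl ! i)"
        by (auto simp: prod_eq_iff)
      show ?case using ij deg dq
        by (auto simp: nb_walk_matrix_def Let_def line_mat_def rev_mat_def sw)
    qed (auto simp: nb_walk_matrix_def Let_def)
    \<comment> \<open>With z = q x and d - 1 = q, the polynomials z^2 - 1 and z^2 - 1 + d - z e
      become q^2 times \<open>Y\<close> and \<open>F e\<close>. The coefficient \<open>- 0\<close>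
      fits \<open>Y\<close> to the shape of \<open>root_sum_quadratic\<close>.\<close>
    define Y where "Y = [:- 1 / q\<^sup>2, - 0, 1 :: complex:]"
    define F where "F e = [:1 / q, - (e / q), 1 :: complex:]" for e
    have id: "(char_poly ?P)\<^sup>2 * Y ^ (2 * n + N) = Y ^ (2 * N) * (\<Prod>e\<leftarrow>?es. F e)\<^sup>2"
    proof (intro poly_eq_poly_eq_iff[THEN iffD1] ext)
      fix x
      define z where "z = q * x"
      have "poly (char_poly ?P) x = det (x \<cdot>\<^sub>m 1\<^sub>m N - ?P)" by (rule poly_char_poly_eq_det[OF Pc])
      also have "x \<cdot>\<^sub>m 1\<^sub>m N - ?P = (1 / q) \<cdot>\<^sub>m (z \<cdot>\<^sub>m 1\<^sub>m N - ?B)"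
        unfolding P using q0 by (intro eq_matI) (auto simp: z_def field_simps)
      finally have C: "det (z \<cdot>\<^sub>m 1\<^sub>m N - ?B) = q ^ N * poly (char_poly ?P) x"
        using q0 by (simp add: field_simps)
      have Yx: "z\<^sup>2 - 1 = q\<^sup>2 * poly Y x" using q0
        by (simp add: z_def Y_def field_simps power2_eq_square)
      have Fx: "z\<^sup>2 - 1 + of_nat d - z * e = q\<^sup>2 * poly (F e) x" for e using q0
        unfolding dq by (simp add: z_def F_def field_simps power2_eq_square)
      have FF: "(\<Prod>e\<leftarrow>es. q\<^sup>2 * poly (F e) x) = (q\<^sup>2) ^ length es * poly (\<Prod>e\<leftarrow>es. F e) x" for es
        by (induction es) auto
      have "(q ^ N * poly (char_poly ?P) x)\<^sup>2 * (q\<^sup>2 * poly Y x) ^ (2 * n + N)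
          = (q\<^sup>2 * poly Y x) ^ (2 * N) * ((q\<^sup>2) ^ n * poly (\<Prod>e\<leftarrow>?es. F e) x)\<^sup>2"
        using ihara_bass[OF ls(1) len, of z] unfolding C Yx[symmetric] FF[of ?es, unfolded len, symmetric] Fx[symmetric] .
      moreover have "(q ^ N * poly (char_poly ?P) x)\<^sup>2 * (q\<^sup>2 * poly Y x) ^ (2 * n + N)
          = q ^ (4 * n + 4 * N) * ((poly (char_poly ?P) x)\<^sup>2 * poly Y x ^ (2 * n + N))"
        by (simp add: power_mult_distrib power_mult[symmetric] power_add algebra_simps flip: power_mult power_add)
      moreover have "(q\<^sup>2 * poly Y x) ^ (2 * N) * ((q\<^sup>2) ^ n * poly (\<Prod>e\<leftarrow>?es. F e) x)\<^sup>2
          = q ^ (4 * n + 4 * N) * (poly Y x ^ (2 * N) * (poly (\<Prod>e\<leftarrow>?es. F e) x)\<^sup>2)"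
        by (simp add: power_mult_distrib algebra_simps flip: power_mult power_add)
      ultimately show "poly ((char_poly ?P)\<^sup>2 * Y ^ (2 * n + N)) x = poly (Y ^ (2 * N) * (\<Prod>e\<leftarrow>?es. F e)\<^sup>2) x"
        using q0 by (simp add: poly_power del: list.map)
    qed
    have nz: "char_poly ?P \<noteq> 0" "Y \<noteq> 0" "(\<Prod>e\<leftarrow>?es. F e) \<noteq> 0"
      using degree_monic_char_poly[OF Pc] by (auto simp: Y_def F_def prod_list_zero_iff simp del: list.map)
    \<comment> \<open>The root sum is additive, so the squares in \<open>id\<close> become factors 2
      that can be divided out, with no square root or sign to choose.\<close>
    have "2 * root_sum (char_poly ?P) + of_nat (2 * n + N) * root_sum Y
        = root_sum ((char_poly ?P)\<^sup>2 * Y ^ (2 * n + N))"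
      using nz(1,2) by (simp add: root_sum_mult root_sum_power)
    also have "\<dots> = of_nat (2 * N) * root_sum Y + 2 * root_sum (\<Prod>e\<leftarrow>?es. F e)"
      unfolding id using nz(2,3) by (simp add: root_sum_mult root_sum_power del: list.map)
    finally have "2 * root_sum (char_poly ?P) + of_nat (2 * n + N) * root_sum Y
        = of_nat (2 * N) * root_sum Y + 2 * root_sum (\<Prod>e\<leftarrow>?es. F e)" .
    then have "root_sum (char_poly ?P) = (of_nat N / 2 - of_nat n) * root_sum Y + root_sum (\<Prod>e\<leftarrow>?es. F e)"
      by (simp add: field_simps)
    also have "root_sum (\<Prod>e\<leftarrow>?es. F e) = (\<Sum>e\<leftarrow>?es. root_sum (F e))"
      by (subst root_sum_prod_list) (auto simp: F_def comp_def simp del: list.map)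
    also have "\<dots> = root_sum (F (of_nat d)) + (\<Sum>l\<leftarrow>ls. root_sum (F (of_real l)))"
      by (simp add: comp_def)
    \<comment> \<open>Here 1 is a root, so \<open>root_sum_quadratic\<close> does not apply. The
      root 1 counts as 0 and the other root 1 / q gives the term (d - 1) / (d - 2).\<close>
    also have "root_sum (F (of_nat d)) = of_real (r / (r - 1))"
    proof -
      have "F (of_nat d) = [:- 1, 1:] * [:- (1 / q), 1:]"
        using q0 by (simp add: F_def dq field_simps)
      then have "root_sum (F (of_nat d)) = 1 / (1 - 1) + 1 / (1 - 1 / q)"
        by (simp only:) (subst root_sum_mult, simp_all only: root_sum_linear pCons_eq_0_iff, auto)
      also have "\<dots> = q / (q - 1)" using q0 by (simp add: divide_simps)
      finally show ?thesis by (simp add: q_def)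
    qed
    also have "root_sum Y = of_real (2 * r\<^sup>2 / (r\<^sup>2 - 1))"
    proof -
      have "r\<^sup>2 > 1" using r by (simp add: one_less_power)
      then have q1: "q\<^sup>2 - 1 \<noteq> 0" unfolding q_def by (metis eq_iff_diff_eq_0 of_real_1 of_real_eq_iff of_real_power less_irrefl)
      have "root_sum Y = 2 / (1 - 0 + (- 1 / q\<^sup>2))"
        unfolding Y_def using q0 q1 by (subst root_sum_quadratic) (auto simp: field_simps)
      also have "\<dots> = 2 * q\<^sup>2 / (q\<^sup>2 - 1)" using q0 q1 by (simp add: divide_simps)
      finally show ?thesis by (simp add: q_def)
    qed
    also have "(\<Sum>l\<leftarrow>ls. root_sum (F (of_real l))) = (\<Sum>l\<leftarrow>ls. complex_of_real ((2 * r - l) / (real d - l)))"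
    proof (intro arg_cong[of _ _ sum_list] map_cong refl)
      fix l assume "l \<in> set ls"
      from bd[OF this] have "l \<noteq> r + 1" by (simp add: r_def)
      then have l: "q + 1 - of_real l \<noteq> 0" unfolding q_def
        by (metis eq_iff_diff_eq_0 of_real_1 of_real_add of_real_eq_iff)
      have e: "1 - of_real l / q + 1 / q = (q + 1 - of_real l) / q" using q0 by (simp add: field_simps)
      have "root_sum (F (of_real l)) = (2 - of_real l / q) / ((q + 1 - of_real l) / q)"
        unfolding F_def using q0 l e by (subst root_sum_quadratic) auto
      also have "\<dots> = (2 * q - of_real l) / q / ((q + 1 - of_real l) / q)" using q0 by (simp add: diff_divide_distrib)
      also have "\<dots> = (2 * q - of_real l) / (q + 1 - of_real l)" using q0 l by (simp only: divide_divide_eq_right) simp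
      finally show "root_sum (F (of_real l)) = of_real ((2 * r - l) / (real d - l))"
        by (simp add: q_def r_def)
    qed
    also have "\<dots> = of_real (\<Sum>l\<leftarrow>ls. (2 * r - l) / (real d - l))" by (induction ls) auto
    also have "(of_nat N / 2 - of_nat n) * complex_of_real (2 * r\<^sup>2 / (r\<^sup>2 - 1)) + (of_real (r / (r - 1))
        + of_real (\<Sum>l\<leftarrow>ls. (2 * r - l) / (real d - l)))
      = of_real ((real N / 2 - real n) * (2 * r\<^sup>2 / (r\<^sup>2 - 1)) + (r / (r - 1)
        + (\<Sum>l\<leftarrow>ls. (2 * r - l) / (real d - l))))" by simp
    finally have "kemeny_nb V E = (real N / 2 - real n) * (2 * r\<^sup>2 / (r\<^sup>2 - 1)) + (r / (r - 1)
        + (\<Sum>l\<leftarrow>ls. (2 * r - l) / (real d - l)))"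
      unfolding kemeny_nb_def kemeny_eq_root_sum by (simp only: Re_complex_of_real)
    also have "(real N / 2 - real n) * (2 * r\<^sup>2 / (r\<^sup>2 - 1)) = real n * r\<^sup>2 / real d"
    proof -
      have 1: "r\<^sup>2 - 1 = real d * (real d - 2)" by (simp add: r_def power2_eq_square algebra_simps)
      have 2: "real N / 2 - real n = real n * (real d - 2) / 2" by (simp add: N_eq field_simps)
      have "real d - 2 \<noteq> 0" using d by auto
      then show ?thesis unfolding 1 2 by simp
    qed
    finally show ?thesis by (simp add: r_def)
  qed
  have jensen: "(\<Sum>l\<leftarrow>ls. real d / (real d - l)) \<ge> (real n - 1)\<^sup>2 / real n"
    \<comment> \<open>sum of the tangent lines of 1 / y at the mean n / (n - 1) of the numbers y = (d - l) / d\<close>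
  proof -
    \<comment> \<open>The l sum to - d, so the n - 1 numbers y sum to n and \<open>b\<close> is the
      reciprocal of their mean. The tangent of 1 / y at 1 / b is 2 b - b^2 y.\<close>
    define b where "b = (real n - 1) / real n"
    have tangent: "2 * b - b\<^sup>2 + b\<^sup>2 / real d * l \<le> real d / (real d - l)" if "l \<in> set ls" for l
    proof -
      define y where "y = (real d - l) / real d"
      have y: "y > 0" using bd[OF that] d0 by (simp add: y_def)
      have "0 \<le> (1 - b * y)\<^sup>2 / y" using y by simp
      also have "\<dots> = 1 / y - (2 * b - b\<^sup>2 * y)" using y by (simp add: field_simps power2_eq_square)
      also have "1 / y = real d / (real d - l)" by (simp add: y_def)
      also have "b\<^sup>2 * y = b\<^sup>2 - b\<^sup>2 / real d * l" using d0 by (simp add: y_def field_simps)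
      finally show ?thesis by simp
    qed
    have lin: "(\<Sum>l\<leftarrow>xs. p + c * l) = real (length xs) * p + c * sum_list xs" for p c :: real and xs
      by (induction xs) (auto simp: algebra_simps)
    have "(real n - 1)\<^sup>2 / real n = (real n - 1) * (2 * b - b\<^sup>2) + b\<^sup>2 / real d * (- real d)"
      using n_pos d0 by (simp add: b_def field_simps power2_eq_square)
    also have "\<dots> = (\<Sum>l\<leftarrow>ls. 2 * b - b\<^sup>2 + b\<^sup>2 / real d * l)"
      unfolding lin spectral_moments(1)[OF ls(1)] ls(2) of_nat_n_minus_1 by simp
    also have "\<dots> \<le> (\<Sum>l\<leftarrow>ls. real d / (real d - l))" by (rule sum_list_mono) (rule tangent)
    finally show ?thesis .
  qed
  have cubic: "(\<Sum>l\<leftarrow>ls. real d / (real d - l)) \<ge> 9 / 2 + closed_triples / 108"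
    if "n = 6" "d = 3"
  proof -
    note mom = spectral_moments[OF ls(1)]
    have lin: "(\<Sum>l\<leftarrow>xs. 1 + l / 3 + 3 / 4 * (l / 3) ^ 2 + 1 / 4 * (l / 3) ^ 3)
        = real (length xs) + sum_list xs / 3 + (\<Sum>l\<leftarrow>xs. l ^ 2) / 12 + (\<Sum>l\<leftarrow>xs. l ^ 3) / 108" for xs :: "real list"
      by (induction xs) (auto simp: field_simps power_divide)
    \<comment> \<open>The power sums are - 3, 9 and tr(A^3) - 27 over five eigenvalues, and 5 - 1 +
      9 / 12 - 27 / 108 = 9 / 2.\<close>
    have "9 / 2 + closed_triples / 108 = (\<Sum>l\<leftarrow>ls. 1 + l / 3 + 3 / 4 * (l / 3) ^ 2 + 1 / 4 * (l / 3) ^ 3)"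
      unfolding lin mom using that ls(2) by (simp add: field_simps)
    also have "\<dots> \<le> (\<Sum>l\<leftarrow>ls. real d / (real d - l))"
    proof (rule sum_list_mono)
      fix l assume "l \<in> set ls"
      with bd[of l] that(2) have l: "l < 3" by simp
      have "1 / (1 - l / 3) = real d / (real d - l)" using l that(2) by (simp add: field_simps)
      then show "1 + l / 3 + 3 / 4 * (l / 3) ^ 2 + 1 / 4 * (l / 3) ^ 3 \<le> real d / (real d - l)"
        using inverse_cubic_bound[of "l / 3"] l by simp
    qed
    finally show ?thesis .
  qed
  have lower: "(\<Sum>l\<leftarrow>ls. real d / (real d - l)) > real n / 2 + real d / (2 * (real d - 2))"
  proof (cases "n = 6 \<and> d = 3")
    case True
    then obtain u v w where "E u v" "E v w" "E w u"
      using triangle_free_iso_K33 K33 by blast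
    from closed_triples_pos[OF this] cubic True show ?thesis by simp
  next
    case False
    have "\<not> (d = 3 \<and> n = 4)" "\<not> (d = 4 \<and> n = 5)" using complete_iso K4 K5 by auto
    moreover have "\<not> (d = 3 \<and> n = 5)" using even_nd by auto
    ultimately have nd: "n \<ge> 6" "d = 3 \<Longrightarrow> n \<ge> 7" using False d degree_less by auto
    have e: "real d / (2 * (real d - 2)) = 1 / 2 + 1 / (real d - 2)" using d by (simp add: field_simps)
    \<comment> \<open>Equality is attained for d = 3, n = 7 and for d = 4, n = 6. The strict
      inequality comes from the summand 1 / n in (n - 1)^2 / n = n - 2 + 1 / n.\<close>
    have "1 / (real d - 2) \<le> real n / 2 - 5 / 2"
    proof (cases "d = 3")
      case True
      then show ?thesis using nd by simp
    next
      case False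
      then have "1 / (real d - 2) \<le> 1 / 2" using d by (intro divide_left_mono) auto
      then show ?thesis using nd by simp
    qed
    moreover have inv: "1 / real n > 0" using n_pos by simp
    ultimately have "real n / 2 + real d / (2 * (real d - 2)) < real n - 2 + 1 / real n"
      unfolding e using inv by linarith
    also have "\<dots> = (real n - 1)\<^sup>2 / real n" using n_pos by (simp add: field_simps power2_eq_square)
    also have "\<dots> \<le> (\<Sum>l\<leftarrow>ls. real d / (real d - l))"
      by (rule jensen)
    finally show ?thesis .
  qed
  define K where "K = (\<Sum>l\<leftarrow>ls. real d / (real d - l))"
  define r where "r = real d"
  have r: "r \<ge> 3" using d by (simp add: r_def)
  have n: "real n > 0" using n_pos by simp
  have Ke: "kemeny_e V E = real n * (r - 1) + K"
    using kemeny_e_eq by (simp add: K_def r_def)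
  \<comment> \<open>Each term splits as 1 + (r - 2) / (r - l), which is the source of n - 1 and of
    the factor 1 - 2 / d in front of K.\<close>
  have "(\<Sum>l\<leftarrow>xs. (2 * (r - 1) - l) / (r - l)) = real (length xs) + (r - 2) / r * (\<Sum>l\<leftarrow>xs. r / (r - l))"
    if "\<And>l. l \<in> set xs \<Longrightarrow> l < r" for xs
    using that
  proof (induction xs)
    case (Cons l xs)
    have "(2 * (r - 1) - l) / (r - l) = 1 + (r - 2) / r * (r / (r - l))"
      using r Cons.prems[of l] by (simp add: field_simps)
    then show ?case using Cons by (simp add: algebra_simps)
  qed simp
  from this[of ls] have "(\<Sum>l\<leftarrow>ls. (2 * (r - 1) - l) / (r - l)) = real n - 1 + (r - 2) / r * K"
    using bd ls(2) of_nat_n_minus_1 by (simp add: K_def r_def)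
  then have Knb: "kemeny_nb V E = real n * (r - 1)\<^sup>2 / r + (r - 1) / (r - 2) + (real n - 1 + (r - 2) / r * K)"
    using kemeny_nb_eq by (simp add: r_def)
  have K: "K > real n / 2 + r / (2 * (r - 2))"
    unfolding K_def r_def by (rule lower)
  moreover have "r / (2 * (r - 2)) > 0" using r by simp
  ultimately have "K > 0" using n by linarith
  then have pos: "kemeny_e V E > 0" unfolding Ke using r n by (simp add: add_nonneg_pos)
  \<comment> \<open>The multiple 1 - 2 / d is exactly the one for which \<open>K\<close> cancels, so
    only explicit positive or nonnegative terms remain.\<close>
  have "kemeny_nb V E - (1 - 2 / r) * kemeny_e V E = real n * (r - 1) / r + (real n - 1) + (r - 1) / (r - 2)"
    unfolding Ke Knb using r by (simp add: field_simps power2_eq_square)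
  also have "\<dots> > 0"
  proof -
    have "real n \<ge> 1" using of_nat_n_minus_1 by linarith
    moreover have "real n * (r - 1) / r > 0" using r n by (intro divide_pos_pos mult_pos_pos) linarith+
    moreover have "(r - 1) / (r - 2) > 0" using r by (intro divide_pos_pos) linarith+
    ultimately show ?thesis by linarith
  qed
  finally have lower: "(1 - 2 / r) * kemeny_e V E < kemeny_nb V E" by simp
  \<comment> \<open>The threshold for \<open>K\<close> is the value at which the two constants
    coincide.\<close>
  have "kemeny_e V E - kemeny_nb V E = 2 / r * (K - (real n / 2 + r / (2 * (r - 2))))"
    unfolding Ke Knb using r by (simp add: field_simps power2_eq_square)
  also have "\<dots> > 0" using K r by simp
  finally have "kemeny_nb V E < kemeny_e V E" by simp
  with lower pos show ?thesis by (simp add: pos_less_divide_eq pos_divide_less_eq r_def)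
qed

end
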